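(* Let $\mathcal{P}=\{\mathbf{P}_i\}_{i\in\mathcal{I}}$ be a parameterized program over a family $\mathcal{T}=\{\mathbb{T}_i\}_{i\in\mathcal{I}}$ of topologies with universal structure $\mathbb{T}$. If there is an Ashcroft invariant $\Phi$ of width $k$ for $\mathcal{P}$, and $\mathcal{T}$ has a finite basis of rank $k+1$ consisting of finite topologies, then there is a finitely generated $\mathbb{T}$-proof space that proves $\mathcal{P}$ safe.
   Context: For a structure and a set $V$ of elements, $N(V)$ is the substructure generated by $V$; $N(\vec a)$ that of the entries of tuple $\vec a$; juxtaposition of tuples is concatenation. A local isomorphism from $\vec a$ to $\vec b$ (same length, structures over the same vocabulary) is an isomorphism $\beta:N(\vec a)\to N(\vec b)$ with $\beta(\vec a)=\vec b$; $\vec a\simeq\vec b$ if one exists. An embedding is an injection preserving and reflecting all predicates and functions. Programs. Fix a vocabulary $\mathcal{V}_{\mathsf{Node}}$, a data domain $\mathbb{D}$ (structure over vocabulary $\mathcal{V}_{\mathsf{Data}}$), a finite command set $\Sigma$, a finite location set $\mathbf{L}$ with distinguished $l_{\mathrm{init}},l_{\mathrm{err}}$, and $\mathsf{src},\mathsf{tgt}:\Sigma\to\mathbf{L}$. A topology is a $\mathcal{V}_{\mathsf{Node}}$-structure $\mathbb{T}$. A program over $\mathbb{T}$ is $(P,[\![-]\!])$ with $P:\mathbb{T}\to2^\Sigma$ and relations $[\![\sigma:v]\!]\subseteq(N(v)\to\mathbb{D})^2$. For location maps, $\lambda\xrightarrow{\sigma:v}\lambda'$ iff $\sigma\in P(v)$,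 $\lambda(v)=\mathsf{src}(\sigma)$ and $\lambda'$ is $\lambda$ with $v$ reassigned to $\mathsf{tgt}(\sigma)$. Error runs $\mathcal{L}_{\mathrm{err}}(P)$: words $\langle\sigma_1:a_1\rangle\cdots\langle\sigma_n:a_n\rangle$ with location maps $\lambda_0\equiv l_{\mathrm{init}}$, $\lambda_{r-1}\xrightarrow{\sigma_r:a_r}\lambda_r$, and $l_{\mathrm{err}}$ in the range of $\lambda_n$. For $V\supseteq N(v)$, $\mathsf{Global}_V[\![\sigma:v]\!]$ is the set of pairs of valuations $V\to\mathbb{D}$ whose restrictions to $N(v)$ lie in $[\![\sigma:v]\!]$ and which agree outside $N(v)$, extended to words by composition. A state is $(\lambda,\nu)$ with $\lambda:\mathbb{T}\to\mathbf{L}$, $\nu:\mathbb{T}\to\mathbb{D}$; $(\lambda,\nu)\to(\lambda',\nu')$ iff for some $\langle\sigma:v\rangle$, $\lambda\xrightarrow{\sigma:v}\lambda'$ and $(\nu,\nu')\in\mathsf{Global}_{\mathbb{T}}[\![\sigma:v]\!]$. A run $\rho$ is infeasible if $\mathsf{Global}_{\mathbb{T}}[\![\rho]\!]=\emptyset$; a program is safe if all error runs are infeasible. For a local isomorphism $\beta$, $\beta^*\nu=\nu\circ\beta$ (lifted to pairs and sets). A parameterized program is a family of programs $\mathbf{P}_i=(P_i,[\![-]\!]_i)$ over topologies $\mathbb{T}_i$ (common $\mathcal{V}_{\mathsf{Node}},\mathbb{D},\Sigma,\mathbf{L}$) such that for $a\in\mathbb{T}_i$, $a'\in\mathbb{T}_j$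 and local isomorphism $\beta$ from $a$ to $a'$: $P_i(a)=P_j(a')$ and $[\![\sigma:a]\!]_i=\beta^*[\![\sigma:a']\!]_j$. It is safe if all members are. A universal structure is a $\mathcal{V}_{\mathsf{Node}}$-structure $\mathbb{T}$ into which every $\mathbb{T}_i$ embeds; each $\mathbb{T}_i$ is identified with a substructure of $\mathbb{T}$. Semantics on $\mathbb{T}$: $[\![\sigma:v]\!]=\beta^*[\![\sigma:u]\!]_i$ if some $u\in\mathbb{T}_i$ and local isomorphism $\beta$ from $v$ to $u$ exist, else $\emptyset$. Hoare triples and proof spaces. Assertions: $\phi[\mu(u_1),\dots,\mu(u_m)]$, $\phi$ a $\mathcal{V}_{\mathsf{Data}}$-formula, $u_j\in\mathbb{T}$; $\nu$ satisfies it if $\mathbb{D}\models\phi[\nu(u_1),\dots,\nu(u_m)]$. A triple $\{\phi[\overrightarrow{\mu(u)}]\}\rho\{\psi[\overrightarrow{\mu(w)}]\}$, $\rho=\langle\sigma_1:v_1\rangle\cdots\langle\sigma_n:v_n\rangle$, is valid if with $V=N(\vec u\vec v\vec w)$ every $(\nu,\nu')\in\mathsf{Global}_V[\![\rho]\!]$ with $\nu$ satisfying the precondition has $\nu'$ satisfying the postcondition. Rules (assertions as conjunctions of conjuncts): Sequencing — from $\{A_1\}\rho_1\{A_2\}$, $\{A_2'\}\rho_2\{A_3\}$ with each conjunct of $A_2'$ a conjunct of $A_2$, derive $\{A_1\}\rho_1\rho_2\{A_3\}$; Conjunction — from $\{A_1\}\rho\{B_1\}$, $\{A_2\}\rho\{B_2\}$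 derive $\{A_1\wedge A_2\}\rho\{B_1\wedge B_2\}$; S-param — from a triple with node tuples $\vec u,\vec v,\vec w$ (pre, run, post) derive the same triple with $\vec u',\vec v',\vec w'$ whenever lengths agree and $\vec u\vec v\vec w\simeq\vec u'\vec v'\vec w'$. A $\mathbb{T}$-proof space is a set of triples closed under the rules; it is generated by $H$ if it is the smallest one containing $H$; finitely generated if some finite $H$ generates it; valid if all its triples are valid; $\mathcal{L}(\mathcal{H})=\{\rho:\{\top\}\rho\{\bot\}\in\mathcal{H}\}$. $\mathcal{H}$ proves $\mathcal{P}$ safe if $\mathcal{H}$ is valid and $\bigcup_i\mathcal{L}_{\mathrm{err}}(P_i)\subseteq\mathcal{L}(\mathcal{H})$. Ashcroft invariants. $\mathcal{V}_{\textsc{Ashcroft}}$ is three-sorted ($\mathsf{Node},\mathsf{Data},\mathsf{Loc}$), containing $\mathcal{V}_{\mathsf{Node}}$ on $\mathsf{Node}$, $\mathcal{V}_{\mathsf{Data}}$ on $\mathsf{Data}$, one $\mathsf{Loc}$-constant per element of $\mathbf{L}$, and $\mu:\mathsf{Node}\to\mathsf{Data}$, $\mathtt{l}:\mathsf{Node}\to\mathsf{Loc}$. A QF-Ashcroft formula is a first-order $\mathcal{V}_{\textsc{Ashcroft}}$-formula with no quantifiers over $\mathsf{Node}$ and only free variables of sort $\mathsf{Node}$. An Ashcroft assertion of width $k$ is a sentence $\forall u_1,\dots,u_k.\,\varphi[u_1,\dots,u_k]$ with $\varphi$ QF-Ashcroft. Over a topology $\mathbb{T}$, a state $(\lambda,\nu)$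 interprets $\mathtt{l}$ as $\lambda$ and $\mu$ as $\nu$. $\Phi$ is an Ashcroft invariant for a program over $\mathbb{T}$ if: every state with $\lambda\equiv l_{\mathrm{init}}$ satisfies $\Phi$; if $(\lambda,\nu)\models\Phi$ and $(\lambda,\nu)\to(\lambda',\nu')$ then $(\lambda',\nu')\models\Phi$; and every state satisfying $\Phi$ has $\lambda(u)\neq l_{\mathrm{err}}$ for all $u$. It is an Ashcroft invariant for $\mathcal{P}$ if it is one for every $\mathbf{P}_i$ (over $\mathbb{T}_i$). Basis. For $k\in\mathbb{N}_+$ and a family $\mathcal{T}$ of topologies, a basis of rank $k$ is a subset $\mathcal{S}\subseteq\mathcal{T}$ such that for every $\mathbb{T}'\in\mathcal{T}$ and $\vec a\in\mathbb{T}'^k$ there are $\mathbb{S}\in\mathcal{S}$ and an embedding $f:\mathbb{S}\hookrightarrow\mathbb{T}'$ with $\vec a\in f(\mathbb{S})^k$. *)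

theory Defs
  imports "HOL-Library.FuncSet"
begin

section \<open>Vocabularies and structures\<close>

text \<open>
  A vocabulary is given by sets of function and predicate symbols with arities; constants are
  function symbols of arity 0.  Interpretations are only meaningful on argument lists over the
  universe whose length is the arity.
\<close>

record ('f, 'p) vocab =
  fsyms :: "'f set"
  psyms :: "'p set"
  farity :: "'f \<Rightarrow> nat"
  parity :: "'p \<Rightarrow> nat"

record ('f, 'p, 'a) fostruct =
  univ :: "'a set"
  fint :: "'f \<Rightarrow> 'a list \<Rightarrow> 'a"
  pint :: "'p \<Rightarrow> 'a list \<Rightarrow> bool"

definition is_struct :: "('f, 'p) vocab \<Rightarrow> ('f, 'p, 'a) fostruct \<Rightarrow> bool" where
  "is_struct VV A \<longleftrightarrow> univ A \<noteq> {} \<and>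
     (\<forall>f \<in> fsyms VV. \<forall>xs. length xs = farity VV f \<and> set xs \<subseteq> univ A \<longrightarrow> fint A f xs \<in> univ A)"

text \<open>The universe of the substructure generated by a set; it may be empty.\<close>

inductive_set gen :: "('f, 'p) vocab \<Rightarrow> ('f, 'p, 'a) fostruct \<Rightarrow> 'a set \<Rightarrow> 'a set"
  for VV :: "('f, 'p) vocab" and A :: "('f, 'p, 'a) fostruct" and X :: "'a set" where
  base: "x \<in> X \<Longrightarrow> x \<in> gen VV A X"
| app: "f \<in> fsyms VV \<Longrightarrow> length xs = farity VV f \<Longrightarrow> \<forall>x \<in> set xs. x \<in> gen VV A X \<Longrightarrow>
    fint A f xs \<in> gen VV A X"

definition substruct :: "('f, 'p) vocab \<Rightarrow> ('f, 'p, 'a) fostruct \<Rightarrow> 'a set \<Rightarrow> ('f, 'p, 'a) fostruct" where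
  "substruct VV A X = A\<lparr>univ := gen VV A X\<rparr>"

definition embedding ::
  "('f, 'p) vocab \<Rightarrow> ('f, 'p, 'a) fostruct \<Rightarrow> ('f, 'p, 'b) fostruct \<Rightarrow> ('a \<Rightarrow> 'b) \<Rightarrow> bool" where
  "embedding VV A B h \<longleftrightarrow>
     h ` univ A \<subseteq> univ B \<and> inj_on h (univ A) \<and>
     (\<forall>f \<in> fsyms VV. \<forall>xs. length xs = farity VV f \<and> set xs \<subseteq> univ A \<longrightarrow>
        h (fint A f xs) = fint B f (map h xs)) \<and>
     (\<forall>p \<in> psyms VV. \<forall>xs. length xs = parity VV p \<and> set xs \<subseteq> univ A \<longrightarrow>
        (pint A p xs \<longleftrightarrow> pint B p (map h xs)))"

definition isomorphism ::
  "('f, 'p) vocab \<Rightarrow> ('f, 'p, 'a) fostruct \<Rightarrow> ('f, 'p, 'b) fostruct \<Rightarrow> ('a \<Rightarrow> 'b) \<Rightarrow> bool" where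
  "isomorphism VV A B h \<longleftrightarrow> embedding VV A B h \<and> h ` univ A = univ B"

definition local_iso ::
  "('f, 'p) vocab \<Rightarrow> ('f, 'p, 'a) fostruct \<Rightarrow> 'a list \<Rightarrow> ('f, 'p, 'b) fostruct \<Rightarrow> 'b list \<Rightarrow>
    ('a \<Rightarrow> 'b) \<Rightarrow> bool" where
  "local_iso VV A as B bs \<beta> \<longleftrightarrow>
     set as \<subseteq> univ A \<and> set bs \<subseteq> univ B \<and> length as = length bs \<and>
     isomorphism VV (substruct VV A (set as)) (substruct VV B (set bs)) \<beta> \<and> map \<beta> as = bs"

definition locally_isomorphic ::
  "('f, 'p) vocab \<Rightarrow> ('f, 'p, 'a) fostruct \<Rightarrow> 'a list \<Rightarrow> ('f, 'p, 'b) fostruct \<Rightarrow> 'b list \<Rightarrow> bool" where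
  "locally_isomorphic VV A as B bs \<longleftrightarrow> (\<exists>\<beta>. local_iso VV A as B bs \<beta>)"

definition is_basis ::
  "('f, 'p) vocab \<Rightarrow> nat \<Rightarrow> ('f, 'p, 'a) fostruct set \<Rightarrow> ('f, 'p, 'a) fostruct set \<Rightarrow> bool" where
  "is_basis VV k TT SS \<longleftrightarrow> k > 0 \<and> SS \<subseteq> TT \<and>
     (\<forall>A \<in> TT. \<forall>as. length as = k \<and> set as \<subseteq> univ A \<longrightarrow>
        (\<exists>S \<in> SS. \<exists>f. embedding VV S A f \<and> set as \<subseteq> f ` univ S))"


section \<open>First-order formulas\<close>

datatype 'f tm = Var nat | App 'f "'f tm list"

fun tm_eval :: "('f, 'p, 'a) fostruct \<Rightarrow> (nat \<Rightarrow> 'a) \<Rightarrow> 'f tm \<Rightarrow> 'a" where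
  "tm_eval A s (Var x) = s x"
| "tm_eval A s (App f ts) = fint A f (map (tm_eval A s) ts)"

fun tm_vars :: "'f tm \<Rightarrow> nat set" where
  "tm_vars (Var x) = {x}"
| "tm_vars (App f ts) = (\<Union>t \<in> set ts. tm_vars t)"

fun tm_wf :: "('f, 'p) vocab \<Rightarrow> 'f tm \<Rightarrow> bool" where
  "tm_wf VV (Var x) = True"
| "tm_wf VV (App f ts) = (f \<in> fsyms VV \<and> length ts = farity VV f \<and> (\<forall>t \<in> set ts. tm_wf VV t))"

text \<open>The remaining connectives and the existential quantifier are definable.\<close>

datatype ('f, 'p) fm =
    Bot
  | Eq "'f tm" "'f tm"
  | Pred 'p "'f tm list"
  | Neg "('f, 'p) fm"
  | Conj "('f, 'p) fm" "('f, 'p) fm"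
  | All nat "('f, 'p) fm"

fun fm_sat :: "('f, 'p, 'a) fostruct \<Rightarrow> (nat \<Rightarrow> 'a) \<Rightarrow> ('f, 'p) fm \<Rightarrow> bool" where
  "fm_sat A s Bot = False"
| "fm_sat A s (Eq t u) = (tm_eval A s t = tm_eval A s u)"
| "fm_sat A s (Pred p ts) = pint A p (map (tm_eval A s) ts)"
| "fm_sat A s (Neg \<phi>) = (\<not> fm_sat A s \<phi>)"
| "fm_sat A s (Conj \<phi> \<psi>) = (fm_sat A s \<phi> \<and> fm_sat A s \<psi>)"
| "fm_sat A s (All x \<phi>) = (\<forall>a \<in> univ A. fm_sat A (s(x := a)) \<phi>)"

fun fm_fv :: "('f, 'p) fm \<Rightarrow> nat set" where
  "fm_fv Bot = {}"
| "fm_fv (Eq t u) = tm_vars t \<union> tm_vars u"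
| "fm_fv (Pred p ts) = (\<Union>t \<in> set ts. tm_vars t)"
| "fm_fv (Neg \<phi>) = fm_fv \<phi>"
| "fm_fv (Conj \<phi> \<psi>) = fm_fv \<phi> \<union> fm_fv \<psi>"
| "fm_fv (All x \<phi>) = fm_fv \<phi> - {x}"

fun fm_wf :: "('f, 'p) vocab \<Rightarrow> ('f, 'p) fm \<Rightarrow> bool" where
  "fm_wf VV Bot = True"
| "fm_wf VV (Eq t u) = (tm_wf VV t \<and> tm_wf VV u)"
| "fm_wf VV (Pred p ts) = (p \<in> psyms VV \<and> length ts = parity VV p \<and> (\<forall>t \<in> set ts. tm_wf VV t))"
| "fm_wf VV (Neg \<phi>) = fm_wf VV \<phi>"
| "fm_wf VV (Conj \<phi> \<psi>) = (fm_wf VV \<phi> \<and> fm_wf VV \<psi>)"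
| "fm_wf VV (All x \<phi>) = fm_wf VV \<phi>"


section \<open>Programs\<close>

record ('c, 'l) control =
  cmds :: "'c set"
  locs :: "'l set"
  linit :: 'l
  lerr :: 'l
  src :: "'c \<Rightarrow> 'l"
  tgt :: "'c \<Rightarrow> 'l"

definition is_control :: "('c, 'l) control \<Rightarrow> bool" where
  "is_control C \<longleftrightarrow> finite (cmds C) \<and> finite (locs C) \<and> linit C \<in> locs C \<and> lerr C \<in> locs C \<and>
     src C \<in> cmds C \<rightarrow> locs C \<and> tgt C \<in> cmds C \<rightarrow> locs C"

text \<open>
  Valuations of a node set \<open>X\<close> in the data domain \<open>D\<close> are the extensional functions
  \<open>X \<rightarrow>\<^sub>E univ D\<close>.
\<close>

type_synonym ('c, 'v, 'd) sem = "'c \<Rightarrow> 'v \<Rightarrow> (('v \<Rightarrow> 'd) \<times> ('v \<Rightarrow> 'd)) set"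

record ('c, 'v, 'd) program =
  enabled :: "'v \<Rightarrow> 'c set"
  psem :: "('c, 'v, 'd) sem"

definition is_program ::
  "('f, 'p) vocab \<Rightarrow> ('g, 'q, 'd) fostruct \<Rightarrow> ('c, 'l) control \<Rightarrow> ('f, 'p, 'v) fostruct \<Rightarrow>
    ('c, 'v, 'd) program \<Rightarrow> bool" where
  "is_program VN D C T P \<longleftrightarrow> (\<forall>v \<in> univ T. enabled P v \<subseteq> cmds C \<and>
     (\<forall>\<sigma> \<in> cmds C. psem P \<sigma> v \<subseteq>
        (gen VN T {v} \<rightarrow>\<^sub>E univ D) \<times> (gen VN T {v} \<rightarrow>\<^sub>E univ D)))"

definition loc_step ::
  "('c, 'l) control \<Rightarrow> ('f, 'p, 'v) fostruct \<Rightarrow> ('c, 'v, 'd) program \<Rightarrow>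
    ('v \<Rightarrow> 'l) \<Rightarrow> 'c \<times> 'v \<Rightarrow> ('v \<Rightarrow> 'l) \<Rightarrow> bool" where
  "loc_step C T P loc = (\<lambda>(\<sigma>, v) loc'. v \<in> univ T \<and> \<sigma> \<in> enabled P v \<and> loc v = src C \<sigma> \<and>
     loc' = loc(v := tgt C \<sigma>))"

definition init_loc :: "('c, 'l) control \<Rightarrow> ('f, 'p, 'v) fostruct \<Rightarrow> 'v \<Rightarrow> 'l" where
  "init_loc C T = (\<lambda>v \<in> univ T. linit C)"

definition error_runs ::
  "('c, 'l) control \<Rightarrow> ('f, 'p, 'v) fostruct \<Rightarrow> ('c, 'v, 'd) program \<Rightarrow> ('c \<times> 'v) list set" where
  "error_runs C T P = {\<rho>. \<exists>\<Lambda> :: nat \<Rightarrow> 'v \<Rightarrow> 'l. \<Lambda> 0 = init_loc C T \<and>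
     (\<forall>r < length \<rho>. loc_step C T P (\<Lambda> r) (\<rho> ! r) (\<Lambda> (Suc r))) \<and>
     lerr C \<in> \<Lambda> (length \<rho>) ` univ T}"

definition global ::
  "('f, 'p) vocab \<Rightarrow> ('g, 'q, 'd) fostruct \<Rightarrow> ('f, 'p, 'v) fostruct \<Rightarrow> ('c, 'v, 'd) sem \<Rightarrow>
    'v set \<Rightarrow> 'c \<times> 'v \<Rightarrow> (('v \<Rightarrow> 'd) \<times> ('v \<Rightarrow> 'd)) set" where
  "global VN D T sm X = (\<lambda>(\<sigma>, v). {(\<nu>, \<nu>'). \<nu> \<in> X \<rightarrow>\<^sub>E univ D \<and> \<nu>' \<in> X \<rightarrow>\<^sub>E univ D \<and>
     (restrict \<nu> (gen VN T {v}), restrict \<nu>' (gen VN T {v})) \<in> sm \<sigma> v \<and>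
     (\<forall>x \<in> X - gen VN T {v}. \<nu> x = \<nu>' x)})"

fun global_word ::
  "('f, 'p) vocab \<Rightarrow> ('g, 'q, 'd) fostruct \<Rightarrow> ('f, 'p, 'v) fostruct \<Rightarrow> ('c, 'v, 'd) sem \<Rightarrow>
    'v set \<Rightarrow> ('c \<times> 'v) list \<Rightarrow> (('v \<Rightarrow> 'd) \<times> ('v \<Rightarrow> 'd)) set" where
  "global_word VN D T sm X [] = Id_on (X \<rightarrow>\<^sub>E univ D)"
| "global_word VN D T sm X (a # \<rho>) = global VN D T sm X a O global_word VN D T sm X \<rho>"

type_synonym ('v, 'l, 'd) state = "('v \<Rightarrow> 'l) \<times> ('v \<Rightarrow> 'd)"

definition states ::
  "('g, 'q, 'd) fostruct \<Rightarrow> ('c, 'l) control \<Rightarrow> ('f, 'p, 'v) fostruct \<Rightarrow> ('v, 'l, 'd) state set" where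
  "states D C T = (univ T \<rightarrow>\<^sub>E locs C) \<times> (univ T \<rightarrow>\<^sub>E univ D)"

definition state_step ::
  "('f, 'p) vocab \<Rightarrow> ('g, 'q, 'd) fostruct \<Rightarrow> ('c, 'l) control \<Rightarrow> ('f, 'p, 'v) fostruct \<Rightarrow>
    ('c, 'v, 'd) program \<Rightarrow> ('v, 'l, 'd) state \<Rightarrow> ('v, 'l, 'd) state \<Rightarrow> bool" where
  "state_step VN D C T P st st' \<longleftrightarrow> (\<exists>a. loc_step C T P (fst st) a (fst st') \<and>
     (snd st, snd st') \<in> global VN D T (psem P) (univ T) a)"


section \<open>Parameterized programs and universal structures\<close>

definition pullback :: "'a set \<Rightarrow> ('a \<Rightarrow> 'b) \<Rightarrow> ('b \<Rightarrow> 'd) \<times> ('b \<Rightarrow> 'd) \<Rightarrow> ('a \<Rightarrow> 'd) \<times> ('a \<Rightarrow> 'd)" where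
  "pullback X \<beta> = (\<lambda>(\<nu>, \<nu>'). (compose X \<nu> \<beta>, compose X \<nu>' \<beta>))"

definition parameterized_program ::
  "('f, 'p) vocab \<Rightarrow> ('g, 'q, 'd) fostruct \<Rightarrow> ('c, 'l) control \<Rightarrow> 'i set \<Rightarrow>
    ('i \<Rightarrow> ('f, 'p, 'v) fostruct) \<Rightarrow> ('i \<Rightarrow> ('c, 'v, 'd) program) \<Rightarrow> bool" where
  "parameterized_program VN D C I T P \<longleftrightarrow>
     (\<forall>i \<in> I. is_struct VN (T i) \<and> is_program VN D C (T i) (P i)) \<and>
     (\<forall>i \<in> I. \<forall>j \<in> I. \<forall>a \<in> univ (T i). \<forall>a' \<in> univ (T j). \<forall>\<beta>.
        local_iso VN (T i) [a] (T j) [a'] \<beta> \<longrightarrow>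
          enabled (P i) a = enabled (P j) a' \<and>
          (\<forall>\<sigma> \<in> cmds C. psem (P i) \<sigma> a = pullback (gen VN (T i) {a}) \<beta> ` psem (P j) \<sigma> a'))"

text \<open>
  The identification of each \<open>T i\<close> with a substructure of \<open>U\<close> is kept explicit as the family of
  embeddings \<open>e\<close>.
\<close>

definition universal_structure ::
  "('f, 'p) vocab \<Rightarrow> 'i set \<Rightarrow> ('i \<Rightarrow> ('f, 'p, 'v) fostruct) \<Rightarrow> ('f, 'p, 'u) fostruct \<Rightarrow>
    ('i \<Rightarrow> 'v \<Rightarrow> 'u) \<Rightarrow> bool" where
  "universal_structure VN I T U e \<longleftrightarrow> is_struct VN U \<and> (\<forall>i \<in> I. embedding VN (T i) U (e i))"

text \<open>
  For a parameterized program all pullbacks along local isomorphisms from \<open>v\<close> to a node of some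
  \<open>T i\<close> coincide, so their union is the common value; it is empty if there are none.
\<close>

definition usem ::
  "('f, 'p) vocab \<Rightarrow> 'i set \<Rightarrow> ('i \<Rightarrow> ('f, 'p, 'v) fostruct) \<Rightarrow> ('i \<Rightarrow> ('c, 'v, 'd) program) \<Rightarrow>
    ('f, 'p, 'u) fostruct \<Rightarrow> ('c, 'u, 'd) sem" where
  "usem VN I T P U \<sigma> v =
     (\<Union>(i, u, \<beta>) \<in> {(i, u, \<beta>). i \<in> I \<and> u \<in> univ (T i) \<and> local_iso VN U [v] (T i) [u] \<beta>}.
        pullback (gen VN U {v}) \<beta> ` psem (P i) \<sigma> u)"


section \<open>Hoare triples and proof spaces\<close>

text \<open>
  A conjunct \<open>(\<phi>, us)\<close> stands for \<open>\<phi>[\<mu>(us ! 0), \<mu>(us ! 1), \<dots>]\<close>: the free variable \<open>j\<close> of \<open>\<phi>\<close> denotes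
  the data value of the node \<open>us ! j\<close>.  An assertion is the list of its conjuncts, so concatenation
  is conjunction and the empty list is \<open>\<top>\<close>.
\<close>

type_synonym ('g, 'q, 'u) assertion = "(('g, 'q) fm \<times> 'u list) list"

type_synonym ('g, 'q, 'c, 'u) triple =
  "('g, 'q, 'u) assertion \<times> ('c \<times> 'u) list \<times> ('g, 'q, 'u) assertion"

definition top_assn :: "('g, 'q, 'u) assertion" where
  "top_assn = []"

definition bot_assn :: "('g, 'q, 'u) assertion" where
  "bot_assn = [(Bot, [])]"

definition assn_nodes :: "('g, 'q, 'u) assertion \<Rightarrow> 'u list" where
  "assn_nodes A = concat (map snd A)"

definition assn_wf :: "('g, 'q) vocab \<Rightarrow> ('f, 'p, 'u) fostruct \<Rightarrow> ('g, 'q, 'u) assertion \<Rightarrow> bool" where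
  "assn_wf VD U A \<longleftrightarrow> (\<forall>(\<phi>, us) \<in> set A. fm_wf VD \<phi> \<and> fm_fv \<phi> \<subseteq> {..<length us} \<and> set us \<subseteq> univ U)"

definition assn_sat :: "('g, 'q, 'd) fostruct \<Rightarrow> ('u \<Rightarrow> 'd) \<Rightarrow> ('g, 'q, 'u) assertion \<Rightarrow> bool" where
  "assn_sat D \<nu> A \<longleftrightarrow> (\<forall>(\<phi>, us) \<in> set A. fm_sat D (\<lambda>j. \<nu> (us ! j)) \<phi>)"

definition triple_nodes :: "('g, 'q, 'c, 'u) triple \<Rightarrow> 'u list" where
  "triple_nodes = (\<lambda>(A, \<rho>, B). assn_nodes A @ map snd \<rho> @ assn_nodes B)"

definition triples ::
  "('g, 'q) vocab \<Rightarrow> ('c, 'l) control \<Rightarrow> ('f, 'p, 'u) fostruct \<Rightarrow> ('g, 'q, 'c, 'u) triple set" where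
  "triples VD C U = {(A, \<rho>, B). assn_wf VD U A \<and> set \<rho> \<subseteq> cmds C \<times> univ U \<and> assn_wf VD U B}"

definition triple_valid ::
  "('f, 'p) vocab \<Rightarrow> ('g, 'q, 'd) fostruct \<Rightarrow> ('f, 'p, 'u) fostruct \<Rightarrow> ('c, 'u, 'd) sem \<Rightarrow>
    ('g, 'q, 'c, 'u) triple \<Rightarrow> bool" where
  "triple_valid VN D U sm = (\<lambda>(A, \<rho>, B).
     \<forall>(\<nu>, \<nu>') \<in> global_word VN D U sm (gen VN U (set (triple_nodes (A, \<rho>, B)))) \<rho>.
       assn_sat D \<nu> A \<longrightarrow> assn_sat D \<nu>' B)"

definition same_shape :: "('g, 'q, 'u) assertion \<Rightarrow> ('g, 'q, 'u) assertion \<Rightarrow> bool" where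
  "same_shape = list_all2 (\<lambda>(\<phi>, us) (\<phi>', us'). \<phi> = \<phi>' \<and> length us = length us')"

definition sequencing_closed :: "('g, 'q, 'c, 'u) triple set \<Rightarrow> bool" where
  "sequencing_closed HH \<longleftrightarrow> (\<forall>A\<^sub>1 \<rho>\<^sub>1 A\<^sub>2 A\<^sub>2' \<rho>\<^sub>2 A\<^sub>3.
     (A\<^sub>1, \<rho>\<^sub>1, A\<^sub>2) \<in> HH \<and> (A\<^sub>2', \<rho>\<^sub>2, A\<^sub>3) \<in> HH \<and> set A\<^sub>2' \<subseteq> set A\<^sub>2 \<longrightarrow>
       (A\<^sub>1, \<rho>\<^sub>1 @ \<rho>\<^sub>2, A\<^sub>3) \<in> HH)"

definition conjunction_closed :: "('g, 'q, 'c, 'u) triple set \<Rightarrow> bool" where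
  "conjunction_closed HH \<longleftrightarrow> (\<forall>A\<^sub>1 B\<^sub>1 A\<^sub>2 B\<^sub>2 \<rho>.
     (A\<^sub>1, \<rho>, B\<^sub>1) \<in> HH \<and> (A\<^sub>2, \<rho>, B\<^sub>2) \<in> HH \<longrightarrow> (A\<^sub>1 @ A\<^sub>2, \<rho>, B\<^sub>1 @ B\<^sub>2) \<in> HH)"

definition s_param_closed ::
  "('f, 'p) vocab \<Rightarrow> ('f, 'p, 'u) fostruct \<Rightarrow> ('g, 'q, 'c, 'u) triple set \<Rightarrow> bool" where
  "s_param_closed VN U HH \<longleftrightarrow> (\<forall>A \<rho> B A' \<rho>' B'.
     (A, \<rho>, B) \<in> HH \<and> same_shape A A' \<and> map fst \<rho> = map fst \<rho>' \<and> same_shape B B' \<and>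
     locally_isomorphic VN U (triple_nodes (A, \<rho>, B)) U (triple_nodes (A', \<rho>', B')) \<longrightarrow>
       (A', \<rho>', B') \<in> HH)"

definition proof_space ::
  "('f, 'p) vocab \<Rightarrow> ('g, 'q) vocab \<Rightarrow> ('c, 'l) control \<Rightarrow> ('f, 'p, 'u) fostruct \<Rightarrow>
    ('g, 'q, 'c, 'u) triple set \<Rightarrow> bool" where
  "proof_space VN VD C U HH \<longleftrightarrow> HH \<subseteq> triples VD C U \<and>
     sequencing_closed HH \<and> conjunction_closed HH \<and> s_param_closed VN U HH"

definition generated_by ::
  "('f, 'p) vocab \<Rightarrow> ('g, 'q) vocab \<Rightarrow> ('c, 'l) control \<Rightarrow> ('f, 'p, 'u) fostruct \<Rightarrow>
    ('g, 'q, 'c, 'u) triple set \<Rightarrow> ('g, 'q, 'c, 'u) triple set \<Rightarrow> bool" where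
  "generated_by VN VD C U H HH \<longleftrightarrow> proof_space VN VD C U HH \<and> H \<subseteq> HH \<and>
     (\<forall>HH'. proof_space VN VD C U HH' \<and> H \<subseteq> HH' \<longrightarrow> HH \<subseteq> HH')"

definition finitely_generated ::
  "('f, 'p) vocab \<Rightarrow> ('g, 'q) vocab \<Rightarrow> ('c, 'l) control \<Rightarrow> ('f, 'p, 'u) fostruct \<Rightarrow>
    ('g, 'q, 'c, 'u) triple set \<Rightarrow> bool" where
  "finitely_generated VN VD C U HH \<longleftrightarrow> (\<exists>H. finite H \<and> generated_by VN VD C U H HH)"

definition space_lang :: "('g, 'q, 'c, 'u) triple set \<Rightarrow> ('c \<times> 'u) list set" where
  "space_lang HH = {\<rho>. (top_assn, \<rho>, bot_assn) \<in> HH}"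

definition proves_safe ::
  "('f, 'p) vocab \<Rightarrow> ('g, 'q, 'd) fostruct \<Rightarrow> ('c, 'l) control \<Rightarrow> 'i set \<Rightarrow>
    ('i \<Rightarrow> ('f, 'p, 'v) fostruct) \<Rightarrow> ('i \<Rightarrow> ('c, 'v, 'd) program) \<Rightarrow>
    ('f, 'p, 'u) fostruct \<Rightarrow> ('i \<Rightarrow> 'v \<Rightarrow> 'u) \<Rightarrow> ('g, 'q, 'c, 'u) triple set \<Rightarrow> bool" where
  "proves_safe VN D C I T P U e HH \<longleftrightarrow>
     (\<forall>h \<in> HH. triple_valid VN D U (usem VN I T P U) h) \<and>
     (\<Union>i \<in> I. map (\<lambda>(\<sigma>, v). (\<sigma>, e i v)) ` error_runs C (T i) (P i)) \<subseteq> space_lang HH"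


section \<open>Ashcroft invariants\<close>

text \<open>
  Terms of sort Node are of type \<open>'f tm\<close>; each sort has its own variables, named by natural
  numbers.
\<close>

datatype ('f, 'g) dtm = DVar nat | DApp 'g "('f, 'g) dtm list" | Mu "'f tm"

datatype ('f, 'l) ltm = LVar nat | LConst 'l | LocOf "'f tm"

datatype ('f, 'p, 'g, 'q, 'l) afm =
    ABot
  | AEqN "'f tm" "'f tm"
  | AEqD "('f, 'g) dtm" "('f, 'g) dtm"
  | AEqL "('f, 'l) ltm" "('f, 'l) ltm"
  | APredN 'p "'f tm list"
  | APredD 'q "('f, 'g) dtm list"
  | ANeg "('f, 'p, 'g, 'q, 'l) afm"
  | AConj "('f, 'p, 'g, 'q, 'l) afm" "('f, 'p, 'g, 'q, 'l) afm"
  | AAllN nat "('f, 'p, 'g, 'q, 'l) afm"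
  | AAllD nat "('f, 'p, 'g, 'q, 'l) afm"
  | AAllL nat "('f, 'p, 'g, 'q, 'l) afm"

fun dtm_eval ::
  "('g, 'q, 'd) fostruct \<Rightarrow> ('f, 'p, 'v) fostruct \<Rightarrow> ('v \<Rightarrow> 'd) \<Rightarrow> (nat \<Rightarrow> 'v) \<Rightarrow> (nat \<Rightarrow> 'd) \<Rightarrow>
    ('f, 'g) dtm \<Rightarrow> 'd" where
  "dtm_eval D T \<nu> n d (DVar x) = d x"
| "dtm_eval D T \<nu> n d (DApp g ts) = fint D g (map (dtm_eval D T \<nu> n d) ts)"
| "dtm_eval D T \<nu> n d (Mu t) = \<nu> (tm_eval T n t)"

fun ltm_eval ::
  "('f, 'p, 'v) fostruct \<Rightarrow> ('v \<Rightarrow> 'l) \<Rightarrow> (nat \<Rightarrow> 'v) \<Rightarrow> (nat \<Rightarrow> 'l) \<Rightarrow> ('f, 'l) ltm \<Rightarrow> 'l" where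
  "ltm_eval T loc n l (LVar x) = l x"
| "ltm_eval T loc n l (LConst c) = c"
| "ltm_eval T loc n l (LocOf t) = loc (tm_eval T n t)"

fun afm_sat ::
  "('g, 'q, 'd) fostruct \<Rightarrow> ('c, 'l) control \<Rightarrow> ('f, 'p, 'v) fostruct \<Rightarrow> ('v, 'l, 'd) state \<Rightarrow>
    (nat \<Rightarrow> 'v) \<Rightarrow> (nat \<Rightarrow> 'd) \<Rightarrow> (nat \<Rightarrow> 'l) \<Rightarrow> ('f, 'p, 'g, 'q, 'l) afm \<Rightarrow> bool" where
  "afm_sat D C T st n d l ABot = False"
| "afm_sat D C T st n d l (AEqN t u) = (tm_eval T n t = tm_eval T n u)"
| "afm_sat D C T st n d l (AEqD t u) = (dtm_eval D T (snd st) n d t = dtm_eval D T (snd st) n d u)"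
| "afm_sat D C T st n d l (AEqL t u) = (ltm_eval T (fst st) n l t = ltm_eval T (fst st) n l u)"
| "afm_sat D C T st n d l (APredN p ts) = pint T p (map (tm_eval T n) ts)"
| "afm_sat D C T st n d l (APredD q ts) = pint D q (map (dtm_eval D T (snd st) n d) ts)"
| "afm_sat D C T st n d l (ANeg \<phi>) = (\<not> afm_sat D C T st n d l \<phi>)"
| "afm_sat D C T st n d l (AConj \<phi> \<psi>) = (afm_sat D C T st n d l \<phi> \<and> afm_sat D C T st n d l \<psi>)"
| "afm_sat D C T st n d l (AAllN x \<phi>) = (\<forall>a \<in> univ T. afm_sat D C T st (n(x := a)) d l \<phi>)"
| "afm_sat D C T st n d l (AAllD x \<phi>) = (\<forall>a \<in> univ D. afm_sat D C T st n (d(x := a)) l \<phi>)"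
| "afm_sat D C T st n d l (AAllL x \<phi>) = (\<forall>a \<in> locs C. afm_sat D C T st n d (l(x := a)) \<phi>)"

fun dtm_nvars :: "('f, 'g) dtm \<Rightarrow> nat set" where
  "dtm_nvars (DVar x) = {}"
| "dtm_nvars (DApp g ts) = (\<Union>t \<in> set ts. dtm_nvars t)"
| "dtm_nvars (Mu t) = tm_vars t"

fun dtm_dvars :: "('f, 'g) dtm \<Rightarrow> nat set" where
  "dtm_dvars (DVar x) = {x}"
| "dtm_dvars (DApp g ts) = (\<Union>t \<in> set ts. dtm_dvars t)"
| "dtm_dvars (Mu t) = {}"

fun ltm_nvars :: "('f, 'l) ltm \<Rightarrow> nat set" where
  "ltm_nvars (LVar x) = {}"
| "ltm_nvars (LConst c) = {}"
| "ltm_nvars (LocOf t) = tm_vars t"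

fun ltm_lvars :: "('f, 'l) ltm \<Rightarrow> nat set" where
  "ltm_lvars (LVar x) = {x}"
| "ltm_lvars (LConst c) = {}"
| "ltm_lvars (LocOf t) = {}"

fun afm_nfv :: "('f, 'p, 'g, 'q, 'l) afm \<Rightarrow> nat set" where
  "afm_nfv ABot = {}"
| "afm_nfv (AEqN t u) = tm_vars t \<union> tm_vars u"
| "afm_nfv (AEqD t u) = dtm_nvars t \<union> dtm_nvars u"
| "afm_nfv (AEqL t u) = ltm_nvars t \<union> ltm_nvars u"
| "afm_nfv (APredN p ts) = (\<Union>t \<in> set ts. tm_vars t)"
| "afm_nfv (APredD q ts) = (\<Union>t \<in> set ts. dtm_nvars t)"
| "afm_nfv (ANeg \<phi>) = afm_nfv \<phi>"
| "afm_nfv (AConj \<phi> \<psi>) = afm_nfv \<phi> \<union> afm_nfv \<psi>"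
| "afm_nfv (AAllN x \<phi>) = afm_nfv \<phi> - {x}"
| "afm_nfv (AAllD x \<phi>) = afm_nfv \<phi>"
| "afm_nfv (AAllL x \<phi>) = afm_nfv \<phi>"

fun afm_dfv :: "('f, 'p, 'g, 'q, 'l) afm \<Rightarrow> nat set" where
  "afm_dfv ABot = {}"
| "afm_dfv (AEqN t u) = {}"
| "afm_dfv (AEqD t u) = dtm_dvars t \<union> dtm_dvars u"
| "afm_dfv (AEqL t u) = {}"
| "afm_dfv (APredN p ts) = {}"
| "afm_dfv (APredD q ts) = (\<Union>t \<in> set ts. dtm_dvars t)"
| "afm_dfv (ANeg \<phi>) = afm_dfv \<phi>"
| "afm_dfv (AConj \<phi> \<psi>) = afm_dfv \<phi> \<union> afm_dfv \<psi>"
| "afm_dfv (AAllN x \<phi>) = afm_dfv \<phi>"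
| "afm_dfv (AAllD x \<phi>) = afm_dfv \<phi> - {x}"
| "afm_dfv (AAllL x \<phi>) = afm_dfv \<phi>"

fun afm_lfv :: "('f, 'p, 'g, 'q, 'l) afm \<Rightarrow> nat set" where
  "afm_lfv ABot = {}"
| "afm_lfv (AEqN t u) = {}"
| "afm_lfv (AEqD t u) = {}"
| "afm_lfv (AEqL t u) = ltm_lvars t \<union> ltm_lvars u"
| "afm_lfv (APredN p ts) = {}"
| "afm_lfv (APredD q ts) = {}"
| "afm_lfv (ANeg \<phi>) = afm_lfv \<phi>"
| "afm_lfv (AConj \<phi> \<psi>) = afm_lfv \<phi> \<union> afm_lfv \<psi>"
| "afm_lfv (AAllN x \<phi>) = afm_lfv \<phi>"
| "afm_lfv (AAllD x \<phi>) = afm_lfv \<phi>"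
| "afm_lfv (AAllL x \<phi>) = afm_lfv \<phi> - {x}"

fun dtm_wf :: "('f, 'p) vocab \<Rightarrow> ('g, 'q) vocab \<Rightarrow> ('f, 'g) dtm \<Rightarrow> bool" where
  "dtm_wf VN VD (DVar x) = True"
| "dtm_wf VN VD (DApp g ts) = (g \<in> fsyms VD \<and> length ts = farity VD g \<and> (\<forall>t \<in> set ts. dtm_wf VN VD t))"
| "dtm_wf VN VD (Mu t) = tm_wf VN t"

fun ltm_wf :: "('f, 'p) vocab \<Rightarrow> ('c, 'l) control \<Rightarrow> ('f, 'l) ltm \<Rightarrow> bool" where
  "ltm_wf VN C (LVar x) = True"
| "ltm_wf VN C (LConst c) = (c \<in> locs C)"
| "ltm_wf VN C (LocOf t) = tm_wf VN t"

fun afm_wf ::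
  "('f, 'p) vocab \<Rightarrow> ('g, 'q) vocab \<Rightarrow> ('c, 'l) control \<Rightarrow> ('f, 'p, 'g, 'q, 'l) afm \<Rightarrow> bool" where
  "afm_wf VN VD C ABot = True"
| "afm_wf VN VD C (AEqN t u) = (tm_wf VN t \<and> tm_wf VN u)"
| "afm_wf VN VD C (AEqD t u) = (dtm_wf VN VD t \<and> dtm_wf VN VD u)"
| "afm_wf VN VD C (AEqL t u) = (ltm_wf VN C t \<and> ltm_wf VN C u)"
| "afm_wf VN VD C (APredN p ts) =
     (p \<in> psyms VN \<and> length ts = parity VN p \<and> (\<forall>t \<in> set ts. tm_wf VN t))"
| "afm_wf VN VD C (APredD q ts) =
     (q \<in> psyms VD \<and> length ts = parity VD q \<and> (\<forall>t \<in> set ts. dtm_wf VN VD t))"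
| "afm_wf VN VD C (ANeg \<phi>) = afm_wf VN VD C \<phi>"
| "afm_wf VN VD C (AConj \<phi> \<psi>) = (afm_wf VN VD C \<phi> \<and> afm_wf VN VD C \<psi>)"
| "afm_wf VN VD C (AAllN x \<phi>) = afm_wf VN VD C \<phi>"
| "afm_wf VN VD C (AAllD x \<phi>) = afm_wf VN VD C \<phi>"
| "afm_wf VN VD C (AAllL x \<phi>) = afm_wf VN VD C \<phi>"

fun node_qfree :: "('f, 'p, 'g, 'q, 'l) afm \<Rightarrow> bool" where
  "node_qfree (ANeg \<phi>) = node_qfree \<phi>"
| "node_qfree (AConj \<phi> \<psi>) = (node_qfree \<phi> \<and> node_qfree \<psi>)"
| "node_qfree (AAllN x \<phi>) = False"
| "node_qfree (AAllD x \<phi>) = node_qfree \<phi>"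
| "node_qfree (AAllL x \<phi>) = node_qfree \<phi>"
| "node_qfree _ = True"

definition qf_ashcroft ::
  "('f, 'p) vocab \<Rightarrow> ('g, 'q) vocab \<Rightarrow> ('c, 'l) control \<Rightarrow> ('f, 'p, 'g, 'q, 'l) afm \<Rightarrow> bool" where
  "qf_ashcroft VN VD C \<phi> \<longleftrightarrow> afm_wf VN VD C \<phi> \<and> node_qfree \<phi> \<and> afm_dfv \<phi> = {} \<and> afm_lfv \<phi> = {}"

definition ashcroft_assertion ::
  "('f, 'p) vocab \<Rightarrow> ('g, 'q) vocab \<Rightarrow> ('c, 'l) control \<Rightarrow> nat \<Rightarrow> ('f, 'p, 'g, 'q, 'l) afm \<Rightarrow> bool" where
  "ashcroft_assertion VN VD C k \<Phi> \<longleftrightarrow> (\<exists>us \<phi>. length us = k \<and> distinct us \<and>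
     qf_ashcroft VN VD C \<phi> \<and> afm_nfv \<phi> \<subseteq> set us \<and> \<Phi> = foldr AAllN us \<phi>)"

text \<open>Used for sentences only, whose truth does not depend on the environments.\<close>

definition state_sat ::
  "('g, 'q, 'd) fostruct \<Rightarrow> ('c, 'l) control \<Rightarrow> ('f, 'p, 'v) fostruct \<Rightarrow> ('v, 'l, 'd) state \<Rightarrow>
    ('f, 'p, 'g, 'q, 'l) afm \<Rightarrow> bool" where
  "state_sat D C T st \<Phi> \<longleftrightarrow>
     afm_sat D C T st (\<lambda>_. undefined) (\<lambda>_. undefined) (\<lambda>_. undefined) \<Phi>"

definition ashcroft_invariant ::
  "('f, 'p) vocab \<Rightarrow> ('g, 'q, 'd) fostruct \<Rightarrow> ('c, 'l) control \<Rightarrow> ('f, 'p, 'v) fostruct \<Rightarrow>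
    ('c, 'v, 'd) program \<Rightarrow> ('f, 'p, 'g, 'q, 'l) afm \<Rightarrow> bool" where
  "ashcroft_invariant VN D C T P \<Phi> \<longleftrightarrow>
     (\<forall>st \<in> states D C T. fst st = init_loc C T \<longrightarrow> state_sat D C T st \<Phi>) \<and>
     (\<forall>st \<in> states D C T. \<forall>st' \<in> states D C T.
        state_sat D C T st \<Phi> \<and> state_step VN D C T P st st' \<longrightarrow> state_sat D C T st' \<Phi>) \<and>
     (\<forall>st \<in> states D C T. state_sat D C T st \<Phi> \<longrightarrow> (\<forall>u \<in> univ T. fst st u \<noteq> lerr C))"

end

theory Submission
  imports Defs
begin

text \<open>
  Write \<open>\<Phi> = \<forall>us. \<phi>\<close>.  Over a topology with a fixed location map, every instance of \<open>\<phi>\<close> at a tuple of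
  nodes is a data assertion about the nodes denoted by the terms under \<open>\<mu>\<close>, and this assertion does
  not change when the topology is embedded into a larger one.  Hence each instance at \<open>k\<close> nodes,
  after a step of one further node \<open>v\<close>, already lives in a basis topology containing these \<open>k + 1\<close>
  nodes, and there it follows from all instances before the step, because \<open>\<Phi>\<close> is inductive on the
  basis topology.  The generators are these finitely many triples, together with triples over the
  empty run that express that \<open>\<Phi>\<close> holds initially and excludes error locations.  An error run is
  then annotated from the front, each step using finitely many instances obtained by conjunction.
\<close>

section \<open>Partial embeddings\<close>

text \<open>There is no rule of consequence: sequencing compares conjuncts literally. An instance of
  the invariant must therefore be the very same assertion, formula and node tuple alike, whether it
  is computed in a member topology or in a basis topology embedded into it. This is why node and
  location atoms are replaced by their truth values and the \<mu>-terms are listed in an order fixed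
  by the formula: what remains contains nothing that an embedding changes. The implications that are
  still needed, at the start and at the end of a run, enter as generators over the empty run. The
  triples of a basis topology may mention all of its nodes, not just the k + 1 nodes to be covered,
  since only the conjunction of all instances is inductive there. S-param still applies: embedding
  the basis topology into \<open>U\<close> directly, or through a member topology, gives two copies
  of it that are locally isomorphic at every tuple.\<close>

definition fclosed :: "('f, 'p) vocab \<Rightarrow> ('f, 'p, 'a) fostruct \<Rightarrow> 'a set \<Rightarrow> bool" where
  "fclosed VV A X \<longleftrightarrow>
     (\<forall>f \<in> fsyms VV. \<forall>xs. length xs = farity VV f \<and> set xs \<subseteq> X \<longrightarrow> fint A f xs \<in> X)"

text \<open>Unlike in \<open>embedding\<close>, the domain is an arbitrary set and no codomain is
  prescribed. Full embeddings and local isomorphisms, which live only on a generated set, thus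
  become instances of one notion.\<close>

definition embeds_on ::
  "('f, 'p) vocab \<Rightarrow> 'a set \<Rightarrow> ('f, 'p, 'a) fostruct \<Rightarrow> ('f, 'p, 'b) fostruct \<Rightarrow> ('a \<Rightarrow> 'b) \<Rightarrow> bool" where
  "embeds_on VV X A B h \<longleftrightarrow> inj_on h X \<and>
     (\<forall>f \<in> fsyms VV. \<forall>xs. length xs = farity VV f \<and> set xs \<subseteq> X \<longrightarrow>
        h (fint A f xs) = fint B f (map h xs)) \<and>
     (\<forall>p \<in> psyms VV. \<forall>xs. length xs = parity VV p \<and> set xs \<subseteq> X \<longrightarrow>
        (pint A p xs \<longleftrightarrow> pint B p (map h xs)))"

lemma fclosed_univ: "is_struct VV A \<Longrightarrow> fclosed VV A (univ A)"
  by (auto simp: is_struct_def fclosed_def)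

lemma fclosed_gen: "fclosed VV A (gen VV A X)"
  by (auto simp: fclosed_def intro!: gen.app)

lemma gen_minimal:
  assumes "fclosed VV A Y" "X \<subseteq> Y"
  shows "gen VV A X \<subseteq> Y"
proof
  fix x assume "x \<in> gen VV A X"
  then show "x \<in> Y"
    by induction (use assms in \<open>force simp: fclosed_def\<close>)+
qed

lemma gen_superset: "X \<subseteq> gen VV A X"
  by (auto intro: gen.base)

lemma embedding_iff_embeds_on:
  "embedding VV A B h \<longleftrightarrow> h ` univ A \<subseteq> univ B \<and> embeds_on VV (univ A) A B h"
  by (auto simp: embedding_def embeds_on_def)

lemma embeds_on_subset: "embeds_on VV X A B h \<Longrightarrow> Y \<subseteq> X \<Longrightarrow> embeds_on VV Y A B h"
  by (fastforce simp: embeds_on_def intro: inj_on_subset)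

lemma embeds_on_comp:
  assumes h: "embeds_on VV X A B h" and g: "embeds_on VV Y B C g" and XY: "h ` X \<subseteq> Y"
  shows "embeds_on VV X A C (g \<circ> h)"
  unfolding embeds_on_def
proof (intro conjI ballI allI impI)
  show "inj_on (g \<circ> h) X"
    using assms unfolding embeds_on_def by (meson comp_inj_on inj_on_subset)
next
  fix f xs assume f: "f \<in> fsyms VV" "length xs = farity VV f \<and> set xs \<subseteq> X"
  then have "h (fint A f xs) = fint B f (map h xs)"
    using h by (auto simp: embeds_on_def)
  moreover have "set (map h xs) \<subseteq> Y" "length (map h xs) = farity VV f"
    using f XY by auto
  then have "g (fint B f (map h xs)) = fint C f (map g (map h xs))"
    using f g unfolding embeds_on_def by blast
  ultimately show "(g \<circ> h) (fint A f xs) = fint C f (map (g \<circ> h) xs)"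
    by simp
next
  fix p xs assume p: "p \<in> psyms VV" "length xs = parity VV p \<and> set xs \<subseteq> X"
  then have "pint A p xs = pint B p (map h xs)"
    using h by (auto simp: embeds_on_def)
  moreover have "set (map h xs) \<subseteq> Y" "length (map h xs) = parity VV p"
    using p XY by auto
  then have "pint B p (map h xs) = pint C p (map g (map h xs))"
    using p g unfolding embeds_on_def by blast
  ultimately show "pint A p xs = pint C p (map (g \<circ> h) xs)"
    by simp
qed

lemma embeds_on_inv:
  assumes h: "embeds_on VV X A B h" and cl: "fclosed VV A X"
  shows "embeds_on VV (h ` X) B A (inv_into X h)"
  unfolding embeds_on_def
proof (intro conjI ballI allI impI)
  let ?g = "inv_into X h"
  have inj: "inj_on h X"
    using h by (simp add: embeds_on_def)
  show "inj_on ?g (h ` X)"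
    by (simp add: inj_on_inv_into)
  have pre: "set (map ?g ys) \<subseteq> X \<and> map h (map ?g ys) = ys" if "set ys \<subseteq> h ` X" for ys
    using that by (auto simp: inv_into_into f_inv_into_f map_idI subset_iff)
  show "?g (fint B f ys) = fint A f (map ?g ys)"
    if f: "f \<in> fsyms VV" "length ys = farity VV f \<and> set ys \<subseteq> h ` X" for f ys
  proof -
    have "fint B f ys = h (fint A f (map ?g ys))"
      using f h pre[of ys] unfolding embeds_on_def by (metis length_map)
    \<comment> \<open>Closure of \<open>X\<close> enters here: \<open>inv_into X h\<close> undoes
      \<open>h\<close> only at points of \<open>X\<close>.\<close>
    moreover have "fint A f (map ?g ys) \<in> X"
      using f cl pre[of ys] unfolding fclosed_def by (metis length_map)
    ultimately show ?thesis
      by (simp add: inj)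
  qed
  show "pint B p ys = pint A p (map ?g ys)"
    if p: "p \<in> psyms VV" "length ys = parity VV p \<and> set ys \<subseteq> h ` X" for p ys
    using p h pre[of ys] unfolding embeds_on_def by (metis length_map)
qed

lemma embeds_on_image_gen:
  assumes "embeds_on VV (gen VV A X) A B h"
  shows "h ` gen VV A X = gen VV B (h ` X)"
proof (intro subset_antisym image_subsetI subsetI)
  fix x assume "x \<in> gen VV A X"
  then show "h x \<in> gen VV B (h ` X)"
  proof induction
    case (app f xs)
    then have "h (fint A f xs) = fint B f (map h xs)"
      using assms by (auto simp: embeds_on_def subset_iff)
    with app show ?case
      by (auto intro!: gen.app)
  qed (auto intro: gen.base)
next
  fix y assume "y \<in> gen VV B (h ` X)"
  then show "y \<in> h ` gen VV A X"
  proof induction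
    case (app f ys)
    then have "ys \<in> lists (h ` gen VV A X)"
      by auto
    then obtain xs where xs: "ys = map h xs" "set xs \<subseteq> gen VV A X"
      by (auto simp: lists_image)
    with app have "fint B f ys = h (fint A f xs)" "fint A f xs \<in> gen VV A X"
      using assms by (auto simp: embeds_on_def subset_iff intro!: gen.app)
    then show ?case
      by auto
  qed (auto intro: gen.base)
qed

lemma embeds_on_image_gen_subset:
  assumes "embeds_on VV X A B h" "fclosed VV A X" "Z \<subseteq> X"
  shows "h ` gen VV A Z = gen VV B (h ` Z)"
  using embeds_on_image_gen[OF embeds_on_subset[OF assms(1) gen_minimal[OF assms(2,3)]]] .

section \<open>Local isomorphisms\<close>

lemma local_iso_iff:
  "local_iso VV A as B bs \<beta> \<longleftrightarrow> set as \<subseteq> univ A \<and> set bs \<subseteq> univ B \<and> map \<beta> as = bs \<and>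
     embeds_on VV (gen VV A (set as)) A B \<beta>"
proof -
  \<comment> \<open>Surjectivity is automatic: a partial embedding carries the set generated by a
    tuple onto the set generated by the image tuple.\<close>
  have "\<beta> ` gen VV A (set as) = gen VV B (set bs)"
    if "embeds_on VV (gen VV A (set as)) A B \<beta>" "map \<beta> as = bs"
    using embeds_on_image_gen[OF that(1)] that(2) by auto
  moreover have "embeds_on VV X (substruct VV A X') (substruct VV B Y') \<beta> = embeds_on VV X A B \<beta>"
    for X X' Y'
    by (simp add: embeds_on_def substruct_def)
  ultimately show ?thesis
    unfolding local_iso_def isomorphism_def embedding_iff_embeds_on
    by (fastforce simp: substruct_def)
qed

lemma local_iso_embedding:
  assumes "is_struct VV A" "embedding VV A B h" "set as \<subseteq> univ A"
  shows "local_iso VV A as B (map h as) h"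
proof -
  have "embeds_on VV (gen VV A (set as)) A B h"
    using assms(2) gen_minimal[OF fclosed_univ[OF assms(1)] assms(3)]
    unfolding embedding_iff_embeds_on by (blast intro: embeds_on_subset)
  then show ?thesis
    using assms(2,3) by (auto simp: local_iso_iff embedding_iff_embeds_on)
qed

lemma local_iso_trans:
  assumes "local_iso VV A as B bs h" "local_iso VV B bs C cs g"
  shows "local_iso VV A as C cs (g \<circ> h)"
proof -
  have "embeds_on VV (gen VV A (set as)) A B h" and bs: "bs = map h as"
    using assms by (auto simp: local_iso_iff)
  from embeds_on_image_gen[OF this(1)] this(1)
  have "embeds_on VV (gen VV A (set as)) A C (g \<circ> h)"
    using assms(2) by (auto simp: local_iso_iff bs intro: embeds_on_comp)
  then show ?thesis
    using assms by (auto simp: local_iso_iff)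
qed

lemma local_iso_sym:
  assumes "local_iso VV A as B bs h"
  shows "local_iso VV B bs A as (inv_into (gen VV A (set as)) h)"
proof -
  have h: "embeds_on VV (gen VV A (set as)) A B h" and bs: "bs = map h as"
    using assms by (auto simp: local_iso_iff)
  have "map (inv_into (gen VV A (set as)) h) (map h as) = as"
    using h gen_superset by (auto simp: embeds_on_def map_idI gen.base)
  then show ?thesis
    using assms embeds_on_inv[OF h fclosed_gen] embeds_on_image_gen[OF h]
    by (auto simp: local_iso_iff)
qed

text \<open>Go back along \<open>g\<close> and forward along \<open>h\<close>. When \<open>A\<close>
  and \<open>B\<close> are both the universal structure, this relates two copies of one topology at
  every tuple, which is the side condition of S-param.\<close>

lemma locally_isomorphic_embeddings:
  assumes "is_struct VV S" "embedding VV S A g" "embedding VV S B h" "set as \<subseteq> univ S"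
  shows "locally_isomorphic VV A (map g as) B (map h as)"
  using local_iso_trans[OF local_iso_sym[OF local_iso_embedding[OF assms(1,2,4)]]
      local_iso_embedding[OF assms(1,3,4)]]
  unfolding locally_isomorphic_def by blast

lemma embedding_comp:
  assumes "embedding VV A B h" "embedding VV B C g"
  shows "embedding VV A C (g \<circ> h)"
  using assms by (auto simp: embedding_iff_embeds_on intro!: embeds_on_comp)

section \<open>Terms and formulas under partial embeddings and changes of environment\<close>

lemma tm_eval_in:
  assumes "fclosed VV A X" "tm_wf VV t" "s ` tm_vars t \<subseteq> X"
  shows "tm_eval A s t \<in> X"
  using assms(2,3)
proof (induction t)
  case (App f ts)
  then have "set (map (tm_eval A s) ts) \<subseteq> X"
    by fastforce
  with App show ?case
    using assms(1) by (simp add: fclosed_def)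
qed simp

lemma tm_eval_embeds_on:
  assumes "embeds_on VV X A B h" "fclosed VV A X" "tm_wf VV t" "s ` tm_vars t \<subseteq> X"
    "\<And>x. x \<in> tm_vars t \<Longrightarrow> s' x = h (s x)"
  shows "tm_eval B s' t = h (tm_eval A s t)"
  using assms(3-)
proof (induction t)
  case (App f ts)
  have "set (map (tm_eval A s) ts) \<subseteq> X"
    using App.prems by (force intro!: tm_eval_in[OF assms(2)])
  moreover have "map (tm_eval B s') ts = map h (map (tm_eval A s) ts)"
    using App by (force simp: o_def)
  ultimately show ?case
    using App.prems assms(1) by (simp add: embeds_on_def del: map_map map_eq_conv set_map)
qed simp

lemma tm_eval_cong: "(\<And>x. x \<in> tm_vars t \<Longrightarrow> s x = s' x) \<Longrightarrow> tm_eval A s t = tm_eval A s' t"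
proof (induction t)
  case (App f ts)
  then have "map (tm_eval A s) ts = map (tm_eval A s') ts"
    by (intro map_cong refl) (auto simp: Bex_def)
  then show ?case
    by (simp del: map_eq_conv)
qed simp

lemma fm_sat_cong: "(\<And>x. x \<in> fm_fv \<phi> \<Longrightarrow> s x = s' x) \<Longrightarrow> fm_sat A s \<phi> = fm_sat A s' \<phi>"
proof (induction \<phi> arbitrary: s s')
  case (Eq t u)
  then show ?case
    by (metis UnI1 UnI2 fm_fv.simps(2) fm_sat.simps(2) tm_eval_cong)
next
  case (Pred p ts)
  then have "map (tm_eval A s) ts = map (tm_eval A s') ts"
    by (auto intro!: tm_eval_cong)
  then show ?case
    by (simp del: map_eq_conv)
next
  case (Neg \<phi>)
  then show ?case
    by (metis fm_fv.simps(4) fm_sat.simps(4))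
next
  case (Conj \<phi> \<psi>)
  then show ?case
    by (metis UnI1 UnI2 fm_fv.simps(5) fm_sat.simps(5))
next
  case (All x \<phi>)
  have "fm_sat A (s(x := a)) \<phi> = fm_sat A (s'(x := a)) \<phi>" for a
    by (rule All.IH) (use All.prems in auto)
  then show ?case
    by simp
qed simp

section \<open>Transport of runs and soundness of the rules\<close>

definition map_assn :: "('u \<Rightarrow> 'w) \<Rightarrow> ('g, 'q, 'u) assertion \<Rightarrow> ('g, 'q, 'w) assertion" where
  "map_assn h = map (\<lambda>(\<phi>, us). (\<phi>, map h us))"

definition map_run :: "('u \<Rightarrow> 'w) \<Rightarrow> ('c \<times> 'u) list \<Rightarrow> ('c \<times> 'w) list" where
  "map_run h = map (\<lambda>(\<sigma>, v). (\<sigma>, h v))"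

definition map_triple :: "('u \<Rightarrow> 'w) \<Rightarrow> ('g, 'q, 'c, 'u) triple \<Rightarrow> ('g, 'q, 'c, 'w) triple" where
  "map_triple h = (\<lambda>(A, \<rho>, B). (map_assn h A, map_run h \<rho>, map_assn h B))"

lemma assn_nodes_map_assn: "assn_nodes (map_assn h A) = map h (assn_nodes A)"
  by (induction A) (auto simp: assn_nodes_def map_assn_def)

lemma triple_nodes_map_triple: "triple_nodes (map_triple h t) = map h (triple_nodes t)"
  by (auto simp: triple_nodes_def map_triple_def assn_nodes_map_assn map_run_def split: prod.splits)

text \<open>Transitions travel backwards along \<open>h\<close>, so that validity, which quantifies
  over all transitions, travels forwards.\<close>

lemma global_pullback:
  assumes h: "embeds_on VN X A B h" and X: "fclosed VN A X" and v: "v \<in> X"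
    and sm: "\<And>x x'. (x, x') \<in> smB \<sigma> (h v) \<Longrightarrow> pullback (gen VN A {v}) h (x, x') \<in> smA \<sigma> v"
    and step: "(\<nu>, \<nu>') \<in> global VN D B smB (h ` X) (\<sigma>, h v)"
  shows "(compose X \<nu> h, compose X \<nu>' h) \<in> global VN D A smA X (\<sigma>, v)"
proof -
  have gX: "gen VN A {v} \<subseteq> X"
    using X v by (intro gen_minimal) auto
  have img: "h ` gen VN A {v} = gen VN B {h v}"
    using embeds_on_image_gen_subset[OF h X, of "{v}"] v by simp
  have inj: "inj_on h X"
    using h by (simp add: embeds_on_def)
  have r: "restrict (compose X \<mu> h) (gen VN A {v}) =
      compose (gen VN A {v}) (restrict \<mu> (gen VN B {h v})) h" for \<mu> :: "_ \<Rightarrow> 'e"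
    using gX img by (auto simp: compose_def fun_eq_iff)
  \<comment> \<open>Frame condition: by injectivity a node outside the set generated by
    \<open>v\<close> is sent outside the set generated by \<open>h v\<close>.\<close>
  have "h x \<in> h ` X - gen VN B {h v}" if "x \<in> X - gen VN A {v}" for x
    using that gX inj by (auto simp: img[symmetric] dest: inj_onD)
  moreover have "compose X \<mu> h \<in> X \<rightarrow>\<^sub>E univ D" if "\<mu> \<in> h ` X \<rightarrow>\<^sub>E univ D" for \<mu>
    using that by (auto simp: compose_def)
  ultimately show ?thesis
    using step sm by (auto simp: global_def r pullback_def compose_eq)
qed

lemma global_word_pullback:
  assumes h: "embeds_on VN X A B h" and X: "fclosed VN A X" and \<rho>: "snd ` set \<rho> \<subseteq> X"
    and sm: "\<And>\<sigma> v x x'. (\<sigma>, v) \<in> set \<rho> \<Longrightarrow> (x, x') \<in> smB \<sigma> (h v) \<Longrightarrow>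
      pullback (gen VN A {v}) h (x, x') \<in> smA \<sigma> v"
    and run: "(\<nu>, \<nu>') \<in> global_word VN D B smB (h ` X) (map_run h \<rho>)"
  shows "(compose X \<nu> h, compose X \<nu>' h) \<in> global_word VN D A smA X \<rho>"
  using \<rho> sm run
proof (induction \<rho> arbitrary: \<nu>)
  case Nil
  then show ?case
    by (auto simp: Id_on_iff compose_def map_run_def)
next
  case (Cons a \<rho>)
  obtain \<sigma> v where a: "a = (\<sigma>, v)"
    by fastforce
  with Cons.prems obtain \<mu> where \<mu>: "(\<nu>, \<mu>) \<in> global VN D B smB (h ` X) (\<sigma>, h v)"
    "(\<mu>, \<nu>') \<in> global_word VN D B smB (h ` X) (map_run h \<rho>)"
    by (auto simp: map_run_def)
  have "v \<in> X" "snd ` set \<rho> \<subseteq> X"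
    using Cons.prems(1) a by auto
  then have "(compose X \<nu> h, compose X \<mu> h) \<in> global VN D A smA X (\<sigma>, v)"
    using \<mu>(1) Cons.prems(2) a by (intro global_pullback[OF h X]) auto
  moreover have "(compose X \<mu> h, compose X \<nu>' h) \<in> global_word VN D A smA X \<rho>"
    by (rule Cons.IH[OF \<open>snd ` set \<rho> \<subseteq> X\<close> Cons.prems(2) \<mu>(2)]) auto
  ultimately show ?case
    unfolding a global_word.simps by (rule relcompI)
qed

lemma global_word_append:
  "global_word VN D U sm V (\<rho>\<^sub>1 @ \<rho>\<^sub>2) = global_word VN D U sm V \<rho>\<^sub>1 O global_word VN D U sm V \<rho>\<^sub>2"
proof (induction \<rho>\<^sub>1)
  case Nil
  have "global_word VN D U sm V \<rho>\<^sub>2 \<subseteq> (V \<rightarrow>\<^sub>E univ D) \<times> UNIV"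
    by (cases \<rho>\<^sub>2) (auto simp: global_def)
  then show ?case
    by auto
qed (simp add: O_assoc)

lemma global_word_restrict:
  assumes "V \<subseteq> W" "\<And>v. v \<in> snd ` set \<rho> \<Longrightarrow> gen VN U {v} \<subseteq> V"
    "(\<nu>, \<nu>') \<in> global_word VN D U sm W \<rho>"
  shows "(restrict \<nu> V, restrict \<nu>' V) \<in> global_word VN D U sm V \<rho>"
  using assms(2,3)
proof (induction \<rho> arbitrary: \<nu>)
  case Nil
  then show ?case
    using assms(1) by (auto simp: Id_on_iff PiE_iff extensional_def)
next
  case (Cons a \<rho>)
  obtain \<sigma> v where a: "a = (\<sigma>, v)"
    by fastforce
  with Cons.prems obtain \<mu> where \<mu>: "(\<nu>, \<mu>) \<in> global VN D U sm W (\<sigma>, v)"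
    "(\<mu>, \<nu>') \<in> global_word VN D U sm W \<rho>"
    by auto
  have "V \<inter> gen VN U {v} = gen VN U {v}"
    using Cons.prems(1) a by auto
  then have "(restrict \<nu> V, restrict \<mu> V) \<in> global VN D U sm V (\<sigma>, v)"
    using \<mu>(1) assms(1) by (auto simp: global_def PiE_iff subset_iff extensional_def)
  moreover have "(restrict \<mu> V, restrict \<nu>' V) \<in> global_word VN D U sm V \<rho>"
    by (rule Cons.IH[OF _ \<mu>(2)]) (use Cons.prems(1) in auto)
  ultimately show ?case
    unfolding a global_word.simps by (rule relcompI)
qed

text \<open>Filling all valuations with the same \<open>d\<close> keeps the frame condition at the
  new nodes, and no command of the run touches these, since everything generated by its nodes lies
  in \<open>V\<close>.\<close>

lemma global_word_extend:
  assumes "V \<subseteq> W" "\<And>v. v \<in> snd ` set \<rho> \<Longrightarrow> gen VN U {v} \<subseteq> V" "d \<in> univ D"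
    "(\<nu>, \<nu>') \<in> global_word VN D U sm V \<rho>"
  shows "(\<lambda>x \<in> W. if x \<in> V then \<nu> x else d, \<lambda>x \<in> W. if x \<in> V then \<nu>' x else d)
    \<in> global_word VN D U sm W \<rho>"
  using assms(2,4)
proof (induction \<rho> arbitrary: \<nu>)
  case Nil
  then show ?case
    using assms(1,3) by (auto simp: Id_on_iff PiE_iff extensional_def)
next
  case (Cons a \<rho>)
  let ?E = "\<lambda>\<nu>. \<lambda>x \<in> W. if x \<in> V then \<nu> x else d"
  obtain \<sigma> v where a: "a = (\<sigma>, v)"
    by fastforce
  with Cons.prems obtain \<mu> where \<mu>: "(\<nu>, \<mu>) \<in> global VN D U sm V (\<sigma>, v)"
    "(\<mu>, \<nu>') \<in> global_word VN D U sm V \<rho>"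
    by auto
  have gV: "gen VN U {v} \<subseteq> V"
    using Cons.prems(1) a by auto
  have "restrict (?E \<kappa>) (gen VN U {v}) = restrict \<kappa> (gen VN U {v})" for \<kappa>
    using gV assms(1) by (auto simp: fun_eq_iff)
  then have "(?E \<nu>, ?E \<mu>) \<in> global VN D U sm W (\<sigma>, v)"
    using \<mu>(1) assms(3) by (auto simp: global_def PiE_iff extensional_def)
  moreover have "(?E \<mu>, ?E \<nu>') \<in> global_word VN D U sm W \<rho>"
    by (rule Cons.IH[OF _ \<mu>(2)]) (use Cons.prems(1) in auto)
  ultimately show ?case
    unfolding a global_word.simps by (rule relcompI)
qed

lemma assn_sat_cong:
  assumes "assn_wf VD U A" "\<And>x. x \<in> set (assn_nodes A) \<Longrightarrow> \<nu> x = \<nu>' x"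
  shows "assn_sat D \<nu> A = assn_sat D \<nu>' A"
proof -
  have "fm_sat D (\<lambda>j. \<nu> (us ! j)) \<phi> = fm_sat D (\<lambda>j. \<nu>' (us ! j)) \<phi>" if "(\<phi>, us) \<in> set A" for \<phi> us
  proof (rule fm_sat_cong)
    fix j assume "j \<in> fm_fv \<phi>"
    then have "us ! j \<in> set us"
      using assms(1) that by (fastforce simp: assn_wf_def)
    then show "\<nu> (us ! j) = \<nu>' (us ! j)"
      using assms(2) that by (force simp: assn_nodes_def)
  qed
  then show ?thesis
    by (auto simp: assn_sat_def)
qed

text \<open>Validity may be checked over any larger set of nodes, because valuations extend
  arbitrarily; this makes sequencing sound although its conclusion forgets the nodes of the
  middle assertion.\<close>

lemma triple_valid_iff:
  assumes "(A, \<rho>, B) \<in> triples VD C U" "gen VN U (set (triple_nodes (A, \<rho>, B))) \<subseteq> V" "univ D \<noteq> {}"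
  shows "triple_valid VN D U sm (A, \<rho>, B) \<longleftrightarrow>
    (\<forall>(\<nu>, \<nu>') \<in> global_word VN D U sm V \<rho>. assn_sat D \<nu> A \<longrightarrow> assn_sat D \<nu>' B)"
proof -
  let ?G = "gen VN U (set (triple_nodes (A, \<rho>, B)))"
  have wf: "assn_wf VD U A" "assn_wf VD U B"
    using assms(1) by (auto simp: triples_def)
  have nodes: "set (assn_nodes A) \<subseteq> ?G" "set (assn_nodes B) \<subseteq> ?G" "snd ` set \<rho> \<subseteq> ?G"
    using gen_superset[of "set (triple_nodes (A, \<rho>, B))" VN U] by (auto simp: triple_nodes_def)
  then have gen: "gen VN U {v} \<subseteq> ?G" if "v \<in> snd ` set \<rho>" for v
    using that by (intro gen_minimal[OF fclosed_gen]) auto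
  obtain d where d: "d \<in> univ D"
    using assms(3) by auto
  let ?E = "\<lambda>\<nu>. \<lambda>x \<in> V. if x \<in> ?G then \<nu> x else d"
  have E: "assn_sat D (?E \<nu>) A = assn_sat D \<nu> A" "assn_sat D (?E \<nu>) B = assn_sat D \<nu> B" for \<nu>
    using nodes(1,2) assms(2) by (auto intro!: assn_sat_cong[OF wf(1)] assn_sat_cong[OF wf(2)])
  have R: "assn_sat D (restrict \<nu> ?G) A = assn_sat D \<nu> A"
    "assn_sat D (restrict \<nu> ?G) B = assn_sat D \<nu> B" for \<nu>
    using nodes(1,2) by (auto intro!: assn_sat_cong[OF wf(1)] assn_sat_cong[OF wf(2)])
  show ?thesis
  proof
    assume L: "triple_valid VN D U sm (A, \<rho>, B)"
    have "assn_sat D \<nu>' B" if run: "(\<nu>, \<nu>') \<in> global_word VN D U sm V \<rho>" and "assn_sat D \<nu> A" for \<nu> \<nu>'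
      using L global_word_restrict[OF assms(2) gen run] that(2) R[of \<nu>] R[of \<nu>']
      unfolding triple_valid_def prod.case by blast
    then show "\<forall>(\<nu>, \<nu>') \<in> global_word VN D U sm V \<rho>. assn_sat D \<nu> A \<longrightarrow> assn_sat D \<nu>' B"
      by blast
  next
    assume L: "\<forall>(\<nu>, \<nu>') \<in> global_word VN D U sm V \<rho>. assn_sat D \<nu> A \<longrightarrow> assn_sat D \<nu>' B"
    have "assn_sat D \<nu>' B" if run: "(\<nu>, \<nu>') \<in> global_word VN D U sm ?G \<rho>" and "assn_sat D \<nu> A" for \<nu> \<nu>'
      using L global_word_extend[OF assms(2) gen d run] that(2) E[of \<nu>] E[of \<nu>'] by blast
    then show "triple_valid VN D U sm (A, \<rho>, B)"
      unfolding triple_valid_def prod.case by blast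
  qed
qed

section \<open>Semantics over the universal structure\<close>

lemma usem_pullback:
  assumes "embeds_on VN (gen VN U {v}) U U \<beta>" "v \<in> univ U" "(x, x') \<in> usem VN I T P U \<sigma> (\<beta> v)"
  shows "pullback (gen VN U {v}) \<beta> (x, x') \<in> usem VN I T P U \<sigma> v"
proof -
  obtain i u \<gamma> y y' where *: "i \<in> I" "u \<in> univ (T i)" "local_iso VN U [\<beta> v] (T i) [u] \<gamma>"
    "(y, y') \<in> psem (P i) \<sigma> u" "(x, x') = pullback (gen VN U {\<beta> v}) \<gamma> (y, y')"
    using assms(3) unfolding usem_def by fastforce
  have "local_iso VN U [v] U [\<beta> v] \<beta>"
    using assms(1,2) *(3) by (auto simp: local_iso_iff)
  \<comment> \<open>A witness for \<open>\<beta> v\<close> composed with \<open>\<beta>\<close> is a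
    witness for \<open>v\<close>, and pulling back in two stages is pulling back along the
    composite.\<close>
  then have "local_iso VN U [v] (T i) [u] (\<gamma> \<circ> \<beta>)"
    using *(3) by (rule local_iso_trans)
  moreover have "pullback (gen VN U {v}) \<beta> (x, x') = pullback (gen VN U {v}) (\<gamma> \<circ> \<beta>) (y, y')"
    using *(5) embeds_on_image_gen[OF assms(1)] by (auto simp: pullback_def compose_def fun_eq_iff)
  ultimately show ?thesis
    using *(1,2,4) unfolding usem_def by force
qed

text \<open>The transition at \<open>e j v\<close> may come from any member \<open>i\<close>.
  Composing its witness with \<open>e j\<close> gives a local isomorphism between nodes of two
  members, and there the coherence condition of a parameterized program identifies the
  relations.\<close>

lemma psem_pullback:
  assumes "parameterized_program VN D C I T P" "universal_structure VN I T U e" "j \<in> I"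
    "v \<in> univ (T j)" "\<sigma> \<in> cmds C" "(x, x') \<in> usem VN I T P U \<sigma> (e j v)"
  shows "pullback (gen VN (T j) {v}) (e j) (x, x') \<in> psem (P j) \<sigma> v"
proof -
  obtain i u \<gamma> y y' where *: "i \<in> I" "u \<in> univ (T i)" "local_iso VN U [e j v] (T i) [u] \<gamma>"
    "(y, y') \<in> psem (P i) \<sigma> u" "(x, x') = pullback (gen VN U {e j v}) \<gamma> (y, y')"
    using assms(6) unfolding usem_def by fastforce
  have e: "local_iso VN (T j) [v] U [e j v] (e j)"
    using assms local_iso_embedding[of VN "T j" U "e j" "[v]"]
    by (auto simp: parameterized_program_def universal_structure_def)
  then have "local_iso VN (T j) [v] (T i) [u] (\<gamma> \<circ> e j)"
    using *(3) by (rule local_iso_trans)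
  then have "psem (P j) \<sigma> v = pullback (gen VN (T j) {v}) (\<gamma> \<circ> e j) ` psem (P i) \<sigma> u"
    using assms(1,3,4,5) *(1,2) unfolding parameterized_program_def by blast
  moreover have "pullback (gen VN (T j) {v}) (e j) (x, x') =
      pullback (gen VN (T j) {v}) (\<gamma> \<circ> e j) (y, y')"
    using *(5) e embeds_on_image_gen[of VN "T j" "{v}" U "e j"]
    by (auto simp: local_iso_iff pullback_def compose_def fun_eq_iff)
  ultimately show ?thesis
    using *(4) by simp
qed

section \<open>Node renamings in the S-param rule\<close>

lemma same_shape_map_nodes:
  assumes "same_shape A A'" "map \<beta> (assn_nodes A) = assn_nodes A'"
  shows "A' = map_assn \<beta> A"
  using assms unfolding same_shape_def
proof (induction A A' rule: list_all2_induct)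
  case (Cons a A a' A')
  then show ?case
    by (auto simp: assn_nodes_def map_assn_def append_eq_append_conv split: prod.splits)
qed (simp add: map_assn_def)

lemma assn_sat_map_assn:
  assumes "assn_wf VD U A"
  shows "assn_sat D \<nu> (map_assn \<beta> A) = assn_sat D (\<nu> \<circ> \<beta>) A"
proof -
  have "fm_sat D (\<lambda>j. \<nu> (map \<beta> us ! j)) \<phi> = fm_sat D (\<lambda>j. (\<nu> \<circ> \<beta>) (us ! j)) \<phi>"
    if "(\<phi>, us) \<in> set A" for \<phi> us
    using assms that by (intro fm_sat_cong) (fastforce simp: assn_wf_def)
  then show ?thesis
    by (auto simp: assn_sat_def map_assn_def)
qed

lemma same_shape_length_nodes: "same_shape A A' \<Longrightarrow> length (assn_nodes A) = length (assn_nodes A')"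
  unfolding same_shape_def
  by (induction A A' rule: list_all2_induct) (auto simp: assn_nodes_def)

text \<open>A local isomorphism acts on the concatenated node tuple. Equal lengths of the parts cut
  it back into precondition, run and postcondition, so S-param amounts to renaming all nodes by
  \<open>\<beta>\<close>.\<close>

lemma s_param_map:
  assumes "same_shape A A'" "map fst \<rho> = map fst \<rho>'" "same_shape B B'"
    "map \<beta> (triple_nodes (A, \<rho>, B)) = triple_nodes (A', \<rho>', B')"
  shows "A' = map_assn \<beta> A" "\<rho>' = map_run \<beta> \<rho>"
    "B' = map_assn \<beta> B"
proof -
  have len: "length \<rho> = length \<rho>'"
    using assms(2) by (metis length_map)
  have *: "map \<beta> (assn_nodes A) = assn_nodes A'" "map \<beta> (map snd \<rho>) = map snd \<rho>'"
    "map \<beta> (assn_nodes B) = assn_nodes B'"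
    using assms(4) same_shape_length_nodes[OF assms(1)] len
    by (auto simp: triple_nodes_def append_eq_append_conv)
  show "A' = map_assn \<beta> A" "B' = map_assn \<beta> B"
    using same_shape_map_nodes assms(1,3) *(1,3) by blast+
  have "\<rho>' = zip (map fst \<rho>) (map \<beta> (map snd \<rho>))"
    using assms(2) *(2) by (metis zip_map_fst_snd)
  also have "\<dots> = map_run \<beta> \<rho>"
    by (induction \<rho>) (auto simp: map_run_def)
  finally show "\<rho>' = map_run \<beta> \<rho>" .
qed

section \<open>Soundness of the rules\<close>

lemma proof_space_triples: "proof_space VN VD C U (triples VD C U)"
proof -
  have "(A', \<rho>', B') \<in> triples VD C U"
    if "(A, \<rho>, B) \<in> triples VD C U" "same_shape A A'" "map fst \<rho> = map fst \<rho>'" "same_shape B B'"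
      "local_iso VN U (triple_nodes (A, \<rho>, B)) U (triple_nodes (A', \<rho>', B')) \<beta>" for A \<rho> B A' \<rho>' B' \<beta>
  proof -
    have nodes: "set (triple_nodes (A', \<rho>', B')) \<subseteq> univ U"
      and "map \<beta> (triple_nodes (A, \<rho>, B)) = triple_nodes (A', \<rho>', B')"
      using that(5) by (auto simp: local_iso_iff)
    note eqs = s_param_map[OF that(2-4) this(2)]
    have "assn_wf VD U (map_assn \<beta> E)"
      if "assn_wf VD U E" "set (assn_nodes (map_assn \<beta> E)) \<subseteq> univ U" for E
      using that by (fastforce simp: assn_wf_def assn_nodes_def map_assn_def)
    then have "assn_wf VD U A'" "assn_wf VD U B'"
      using that(1) nodes by (simp_all add: triples_def triple_nodes_def eqs)
    moreover have "fst ` set \<rho> \<subseteq> cmds C"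
      using that(1) by (auto simp: triples_def)
    then have "fst ` set \<rho>' \<subseteq> cmds C"
      using arg_cong[OF that(3), of set] by simp
    moreover have "snd ` set \<rho>' \<subseteq> univ U"
      using nodes by (simp add: triple_nodes_def)
    then have "v \<in> univ U" if "(\<sigma>, v) \<in> set \<rho>'" for \<sigma> v
      using that by force
    ultimately show ?thesis
      unfolding triples_def by force
  qed
  then have "s_param_closed VN U (triples VD C U)"
    unfolding s_param_closed_def locally_isomorphic_def by blast
  moreover have "sequencing_closed (triples VD C U)" "conjunction_closed (triples VD C U)"
    unfolding sequencing_closed_def conjunction_closed_def by (auto simp: triples_def assn_wf_def)
  ultimately show ?thesis
    by (simp add: proof_space_def)
qed

text \<open>Soundness in this form makes a generated proof space valid by minimality. For sequencing
  and conjunction, validity is checked over all of \<open>univ U\<close>, so that the premises speak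
  about the same valuations.\<close>

lemma proof_space_valid:
  assumes D: "univ D \<noteq> {}" and U: "is_struct VN U"
  shows "proof_space VN VD C U
    {h \<in> triples VD C U. triple_valid VN D U (usem VN I T P U) h}" (is "proof_space _ _ _ _ ?V")
proof -
  let ?sm = "usem VN I T P U"
  have sub: "gen VN U (set (triple_nodes h)) \<subseteq> univ U" if "h \<in> triples VD C U" for h
    using that
    by (intro gen_minimal[OF fclosed_univ[OF U]])
      (fastforce simp: triples_def triple_nodes_def assn_nodes_def assn_wf_def)
  have valid: "(A, \<rho>, B) \<in> ?V \<longleftrightarrow> (A, \<rho>, B) \<in> triples VD C U \<and>
    (\<forall>(\<nu>, \<nu>') \<in> global_word VN D U ?sm (univ U) \<rho>. assn_sat D \<nu> A \<longrightarrow> assn_sat D \<nu>' B)" for A \<rho> B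
    using triple_valid_iff[OF _ sub D, of A \<rho> B] by blast
  have tr: "sequencing_closed (triples VD C U)"
    "conjunction_closed (triples VD C U)"
    "s_param_closed VN U (triples VD C U)"
    using proof_space_triples[of VN VD C U] by (auto simp: proof_space_def)
  have "sequencing_closed ?V"
    unfolding sequencing_closed_def
  proof (intro allI impI)
    fix A\<^sub>1 \<rho>\<^sub>1 A\<^sub>2 A\<^sub>2' \<rho>\<^sub>2 A\<^sub>3
    assume h: "(A\<^sub>1, \<rho>\<^sub>1, A\<^sub>2) \<in> ?V \<and> (A\<^sub>2', \<rho>\<^sub>2, A\<^sub>3) \<in> ?V \<and> set A\<^sub>2' \<subseteq> set A\<^sub>2"
    then have "assn_sat D \<nu> A\<^sub>2'" if "assn_sat D \<nu> A\<^sub>2" for \<nu>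
      using that by (auto simp: assn_sat_def)
    moreover have "(A\<^sub>1, \<rho>\<^sub>1 @ \<rho>\<^sub>2, A\<^sub>3) \<in> triples VD C U"
      using h tr(1) unfolding sequencing_closed_def by blast
    ultimately show "(A\<^sub>1, \<rho>\<^sub>1 @ \<rho>\<^sub>2, A\<^sub>3) \<in> ?V"
      using h unfolding valid global_word_append by blast
  qed
  moreover have "conjunction_closed ?V"
    unfolding conjunction_closed_def
  proof (intro allI impI)
    fix A\<^sub>1 B\<^sub>1 A\<^sub>2 B\<^sub>2 \<rho>
    assume h: "(A\<^sub>1, \<rho>, B\<^sub>1) \<in> ?V \<and> (A\<^sub>2, \<rho>, B\<^sub>2) \<in> ?V"
    have "assn_sat D \<nu> (A @ B) = (assn_sat D \<nu> A \<and> assn_sat D \<nu> B)" for \<nu> A B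
      by (auto simp: assn_sat_def)
    moreover have "(A\<^sub>1 @ A\<^sub>2, \<rho>, B\<^sub>1 @ B\<^sub>2) \<in> triples VD C U"
      using h tr(2) unfolding conjunction_closed_def by blast
    ultimately show "(A\<^sub>1 @ A\<^sub>2, \<rho>, B\<^sub>1 @ B\<^sub>2) \<in> ?V"
      using h unfolding valid by blast
  qed
  moreover have "s_param_closed VN U ?V"
    unfolding s_param_closed_def
  proof (intro allI impI)
    fix A \<rho> B A' \<rho>' B'
    assume h: "(A, \<rho>, B) \<in> ?V \<and> same_shape A A' \<and> map fst \<rho> = map fst \<rho>' \<and> same_shape B B' \<and>
      locally_isomorphic VN U (triple_nodes (A, \<rho>, B)) U (triple_nodes (A', \<rho>', B'))"
    then obtain \<beta> where \<beta>: "map \<beta> (triple_nodes (A, \<rho>, B)) = triple_nodes (A', \<rho>', B')"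
      "embeds_on VN (gen VN U (set (triple_nodes (A, \<rho>, B)))) U U \<beta>"
      by (auto simp: local_iso_iff locally_isomorphic_def)
    \<comment> \<open>\<open>\<beta>\<close> is controlled only on the nodes generated by the
      triple, so for S-param validity is taken at exactly that set, and transitions over its image
      are pulled back.\<close>
    let ?G = "gen VN U (set (triple_nodes (A, \<rho>, B)))"
    have t: "(A, \<rho>, B) \<in> triples VD C U" "(A', \<rho>', B') \<in> triples VD C U"
      using h tr(3) unfolding s_param_closed_def by blast+
    have wf: "assn_wf VD U A" "assn_wf VD U B"
      using t(1) by (auto simp: triples_def)
    have eqs: "A' = map_assn \<beta> A" "\<rho>' = map_run \<beta> \<rho>"
      "B' = map_assn \<beta> B"
      using h s_param_map[OF _ _ _ \<beta>(1)] by blast+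
    have G': "gen VN U (set (triple_nodes (A', \<rho>', B'))) = \<beta> ` ?G"
      using embeds_on_image_gen[OF \<beta>(2)] \<beta>(1) by (metis list.set_map)
    have nodes: "set (assn_nodes A) \<subseteq> ?G" "set (assn_nodes B) \<subseteq> ?G" "snd ` set \<rho> \<subseteq> ?G"
      using gen_superset[of "set (triple_nodes (A, \<rho>, B))" VN U] by (auto simp: triple_nodes_def)
    have sat: "assn_sat D \<nu> A' = assn_sat D (compose ?G \<nu> \<beta>) A"
      "assn_sat D \<nu> B' = assn_sat D (compose ?G \<nu> \<beta>) B" for \<nu>
      unfolding eqs assn_sat_map_assn[OF wf(1)] assn_sat_map_assn[OF wf(2)]
      using nodes by (auto intro!: assn_sat_cong[OF wf(1)] assn_sat_cong[OF wf(2)] simp: compose_def)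
    have pull: "(compose ?G \<nu> \<beta>, compose ?G \<nu>' \<beta>) \<in> global_word VN D U ?sm ?G \<rho>"
      if "(\<nu>, \<nu>') \<in> global_word VN D U ?sm (\<beta> ` ?G) \<rho>'" for \<nu> \<nu>'
    proof (rule global_word_pullback[OF \<beta>(2) fclosed_gen nodes(3)])
      fix \<sigma> v x x' assume "(\<sigma>, v) \<in> set \<rho>" and x: "(x, x') \<in> ?sm \<sigma> (\<beta> v)"
      then have v: "v \<in> ?G"
        using nodes(3) by force
      have "embeds_on VN (gen VN U {v}) U U \<beta>"
        using \<beta>(2) by (rule embeds_on_subset) (simp add: v gen_minimal[OF fclosed_gen])
      then show "pullback (gen VN U {v}) \<beta> (x, x') \<in> ?sm \<sigma> v"
        by (rule usem_pullback) (use v sub[OF t(1)] x in auto)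
    qed (use that eqs(2) in simp)
    have "triple_valid VN D U ?sm (A, \<rho>, B)"
      using h by blast
    then have "triple_valid VN D U ?sm (A', \<rho>', B')"
      unfolding triple_valid_def prod.case G' sat using pull by blast
    then show "(A', \<rho>', B') \<in> ?V"
      using t(2) by blast
  qed
  ultimately show ?thesis
    by (auto simp: proof_space_def)
qed

section \<open>Moving triples along embeddings; generated proof spaces\<close>

lemma map_triple_in_triples:
  assumes "t \<in> triples VD C S" "h ` univ S \<subseteq> univ U"
  shows "map_triple h t \<in> triples VD C U"
proof -
  obtain A \<rho> B where t: "t = (A, \<rho>, B)"
    using prod_cases3 by blast
  have "assn_wf VD U (map_assn h E)" if "assn_wf VD S E" for E
    using that assms(2) by (fastforce simp: assn_wf_def map_assn_def)
  moreover have "set (map_run h \<rho>) \<subseteq> cmds C \<times> univ U" if "set \<rho> \<subseteq> cmds C \<times> univ S"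
    using that assms(2) by (fastforce simp: map_run_def)
  ultimately show ?thesis
    using assms(1) by (auto simp: t triples_def map_triple_def)
qed

lemma triple_nodes_subset: "t \<in> triples VD C S \<Longrightarrow> set (triple_nodes t) \<subseteq> univ S"
  by (fastforce simp: triples_def triple_nodes_def assn_nodes_def assn_wf_def)

lemma s_param_closed_map_triple:
  assumes "s_param_closed VN U HH" "map_triple g t \<in> HH" "t \<in> triples VD C S"
    "is_struct VN S" "embedding VN S U g" "embedding VN S U h"
  shows "map_triple h t \<in> HH"
proof -
  obtain A \<rho> B where t: "t = (A, \<rho>, B)"
    using prod_cases3 by blast
  have "same_shape (map_assn g A) (map_assn h A)" "same_shape (map_assn g B) (map_assn h B)"
    by (auto simp: same_shape_def map_assn_def list_all2_map1 list_all2_map2 list.rel_refl split: prod.splits)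
  moreover have "map fst (map_run g \<rho>) = map fst (map_run h \<rho>)"
    by (auto simp: map_run_def)
  moreover have "locally_isomorphic VN U (triple_nodes (map_triple g t)) U (triple_nodes (map_triple h t))"
    unfolding triple_nodes_map_triple
    by (intro locally_isomorphic_embeddings[OF assms(4-6)] triple_nodes_subset[OF assms(3)])
  ultimately show ?thesis
    using assms(1,2) unfolding t map_triple_def prod.case s_param_closed_def by blast
qed

text \<open>Validity is checked over the whole image of \<open>univ (T j)\<close> under
  \<open>e j\<close>, even if the triple generates less. Valuations of that image pull back to
  valuations of the full topology, where \<open>valid\<close> is stated.\<close>

lemma triple_valid_map_triple:
  assumes PP: "parameterized_program VN D C I T P" and U: "universal_structure VN I T U e" and j: "j \<in> I"
    and D: "univ D \<noteq> {}" and t: "(A, \<rho>, B) \<in> triples VD C (T j)"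
    and valid: "\<And>\<nu> \<nu>'. (\<nu>, \<nu>') \<in> global_word VN D (T j) (psem (P j)) (univ (T j)) \<rho> \<Longrightarrow>
      assn_sat D \<nu> A \<Longrightarrow> assn_sat D \<nu>' B"
  shows "triple_valid VN D U (usem VN I T P U) (map_triple (e j) (A, \<rho>, B))"
proof -
  let ?X = "univ (T j)"
  have S: "fclosed VN (T j) ?X"
    using PP j by (auto simp: parameterized_program_def intro: fclosed_univ)
  have e: "embeds_on VN ?X (T j) U (e j)" "e j ` ?X \<subseteq> univ U"
    using U j by (auto simp: universal_structure_def embedding_iff_embeds_on)
  have t': "map_triple (e j) (A, \<rho>, B) \<in> triples VD C U"
    using map_triple_in_triples[OF t e(2)] .
  have nodes: "set (triple_nodes (A, \<rho>, B)) \<subseteq> ?X"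
    using triple_nodes_subset[OF t] .
  have wf: "assn_wf VD (T j) A" "assn_wf VD (T j) B" and \<rho>: "set \<rho> \<subseteq> cmds C \<times> ?X"
    using t by (auto simp: triples_def)
  have "gen VN U (set (triple_nodes (map_triple (e j) (A, \<rho>, B)))) \<subseteq> e j ` ?X"
    using embeds_on_image_gen_subset[OF e(1) S nodes] gen_minimal[OF S nodes]
    by (auto simp: triple_nodes_map_triple)
  moreover have "assn_sat D \<nu>' (map_assn (e j) B)"
    if run: "(\<nu>, \<nu>') \<in> global_word VN D U (usem VN I T P U) (e j ` ?X) (map_run (e j) \<rho>)"
      and pre: "assn_sat D \<nu> (map_assn (e j) A)" for \<nu> \<nu>'
  proof -
    have sat: "assn_sat D \<mu> (map_assn (e j) E) = assn_sat D (compose ?X \<mu> (e j)) E"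
      if "assn_wf VD (T j) E" for E \<mu>
    proof -
      have "set (assn_nodes E) \<subseteq> ?X"
        using that by (fastforce simp: assn_wf_def assn_nodes_def)
      then show ?thesis
        unfolding assn_sat_map_assn[OF that] by (auto intro!: assn_sat_cong[OF that] simp: compose_def)
    qed
    have "(compose ?X \<nu> (e j), compose ?X \<nu>' (e j)) \<in>
        global_word VN D (T j) (psem (P j)) ?X \<rho>"
    proof (rule global_word_pullback[OF e(1) S _ _ run])
      fix \<sigma> v x x' assume "(\<sigma>, v) \<in> set \<rho>" "(x, x') \<in> usem VN I T P U \<sigma> (e j v)"
      then show "pullback (gen VN (T j) {v}) (e j) (x, x') \<in> psem (P j) \<sigma> v"
        using \<rho> by (intro psem_pullback[OF PP U j]) auto
    qed (use \<rho> in auto)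
    then show ?thesis
      using valid pre sat[OF wf(1)] sat[OF wf(2)] by blast
  qed
  ultimately show ?thesis
    using triple_valid_iff[OF t'[unfolded map_triple_def prod.case], of VN "e j ` ?X" D] D
    unfolding map_triple_def prod.case by blast
qed

lemma ex_generated_proof_space:
  assumes "H \<subseteq> triples VD C U"
  shows "\<exists>HH. generated_by VN VD C U H HH"
proof
  let ?S = "{HH. proof_space VN VD C U HH \<and> H \<subseteq> HH}"
  \<comment> \<open>The family must be nonempty: an empty intersection would also contain ill-formed
    triples.\<close>
  have ne: "triples VD C U \<in> ?S"
    using assms proof_space_triples by blast
  have "sequencing_closed (\<Inter>?S)"
    unfolding sequencing_closed_def
  proof (intro allI impI InterI)
    fix A\<^sub>1 \<rho>\<^sub>1 A\<^sub>2 A\<^sub>2' \<rho>\<^sub>2 A\<^sub>3 HH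
    assume "(A\<^sub>1, \<rho>\<^sub>1, A\<^sub>2) \<in> \<Inter>?S \<and> (A\<^sub>2', \<rho>\<^sub>2, A\<^sub>3) \<in> \<Inter>?S \<and> set A\<^sub>2' \<subseteq> set A\<^sub>2" and "HH \<in> ?S"
    then show "(A\<^sub>1, \<rho>\<^sub>1 @ \<rho>\<^sub>2, A\<^sub>3) \<in> HH"
      by (simp add: proof_space_def sequencing_closed_def) blast
  qed
  moreover have "conjunction_closed (\<Inter>?S)"
    unfolding conjunction_closed_def
  proof (intro allI impI InterI)
    fix A\<^sub>1 B\<^sub>1 A\<^sub>2 B\<^sub>2 \<rho> HH
    assume "(A\<^sub>1, \<rho>, B\<^sub>1) \<in> \<Inter>?S \<and> (A\<^sub>2, \<rho>, B\<^sub>2) \<in> \<Inter>?S" and "HH \<in> ?S"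
    then show "(A\<^sub>1 @ A\<^sub>2, \<rho>, B\<^sub>1 @ B\<^sub>2) \<in> HH"
      by (simp add: proof_space_def conjunction_closed_def)
  qed
  moreover have "s_param_closed VN U (\<Inter>?S)"
    unfolding s_param_closed_def
  proof (intro allI impI InterI)
    fix A \<rho> B A' \<rho>' B' HH
    assume "(A, \<rho>, B) \<in> \<Inter>?S \<and> same_shape A A' \<and> map fst \<rho> = map fst \<rho>' \<and> same_shape B B' \<and>
      locally_isomorphic VN U (triple_nodes (A, \<rho>, B)) U (triple_nodes (A', \<rho>', B'))" and "HH \<in> ?S"
    then show "(A', \<rho>', B') \<in> HH"
      by (simp add: proof_space_def s_param_closed_def) blast
  qed
  ultimately show "generated_by VN VD C U H (\<Inter>?S)"
    using ne unfolding generated_by_def proof_space_def by blast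
qed

section \<open>Data part of an Ashcroft formula\<close>

text \<open>The first occurrence is taken because \<open>afm_mus\<close> lists a term once per
  occurrence, and equal terms are to share one data variable.\<close>

fun position :: "'a list \<Rightarrow> 'a \<Rightarrow> nat" where
  "position [] u = 0"
| "position (t # ts) u = (if t = u then 0 else Suc (position ts u))"

fun dtm_shift :: "'f tm list \<Rightarrow> ('f, 'g) dtm \<Rightarrow> 'g tm" where
  "dtm_shift ts (DVar x) = Var (x + length ts)"
| "dtm_shift ts (DApp g us) = App g (map (dtm_shift ts) us)"
| "dtm_shift ts (Mu t) = Var (position ts t)"

definition truth_fm :: "bool \<Rightarrow> ('g, 'q) fm" where
  "truth_fm b = (if b then Neg Bot else Bot)"

text \<open>Node and location atoms of a node-quantifier-free formula are evaluated, quantifiers over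
  locations are expanded over the list \<open>ls\<close>, and the data value of the \<open>j\<close>-th node term of the
  list \<open>ts\<close> becomes variable \<open>j\<close>; data variables are shifted out of the way.\<close>

fun data_part ::
  "'l list \<Rightarrow> ('f, 'p, 'v) fostruct \<Rightarrow> ('v \<Rightarrow> 'l) \<Rightarrow> 'f tm list \<Rightarrow> (nat \<Rightarrow> 'v) \<Rightarrow> (nat \<Rightarrow> 'l) \<Rightarrow>
    ('f, 'p, 'g, 'q, 'l) afm \<Rightarrow> ('g, 'q) fm" where
  "data_part ls T loc ts n l ABot = Bot"
| "data_part ls T loc ts n l (AEqN t u) = truth_fm (tm_eval T n t = tm_eval T n u)"
| "data_part ls T loc ts n l (AEqD t u) = Eq (dtm_shift ts t) (dtm_shift ts u)"
| "data_part ls T loc ts n l (AEqL t u) = truth_fm (ltm_eval T loc n l t = ltm_eval T loc n l u)"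
| "data_part ls T loc ts n l (APredN p us) = truth_fm (pint T p (map (tm_eval T n) us))"
| "data_part ls T loc ts n l (APredD q us) = Pred q (map (dtm_shift ts) us)"
| "data_part ls T loc ts n l (ANeg \<phi>) = Neg (data_part ls T loc ts n l \<phi>)"
| "data_part ls T loc ts n l (AConj \<phi> \<psi>) =
     Conj (data_part ls T loc ts n l \<phi>) (data_part ls T loc ts n l \<psi>)"
| "data_part ls T loc ts n l (AAllN x \<phi>) = Bot"
| "data_part ls T loc ts n l (AAllD x \<phi>) = All (x + length ts) (data_part ls T loc ts n l \<phi>)"
| "data_part ls T loc ts n l (AAllL x \<phi>) =
     foldr Conj (map (\<lambda>c. data_part ls T loc ts n (l(x := c)) \<phi>) ls) (truth_fm True)"

fun dtm_mus :: "('f, 'g) dtm \<Rightarrow> 'f tm list" where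
  "dtm_mus (DVar x) = []"
| "dtm_mus (DApp g us) = concat (map dtm_mus us)"
| "dtm_mus (Mu t) = [t]"

fun afm_mus :: "('f, 'p, 'g, 'q, 'l) afm \<Rightarrow> 'f tm list" where
  "afm_mus (AEqD t u) = dtm_mus t @ dtm_mus u"
| "afm_mus (APredD q us) = concat (map dtm_mus us)"
| "afm_mus (ANeg \<phi>) = afm_mus \<phi>"
| "afm_mus (AConj \<phi> \<psi>) = afm_mus \<phi> @ afm_mus \<psi>"
| "afm_mus (AAllN x \<phi>) = afm_mus \<phi>"
| "afm_mus (AAllD x \<phi>) = afm_mus \<phi>"
| "afm_mus (AAllL x \<phi>) = afm_mus \<phi>"
| "afm_mus _ = []"

lemma position_less: "t \<in> set ts \<Longrightarrow> position ts t < length ts"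
  by (induction ts) auto

lemma nth_position: "t \<in> set ts \<Longrightarrow> ts ! position ts t = t"
  by (induction ts) auto

lemma fm_sat_truth_fm [simp]: "fm_sat D s (truth_fm b) = b"
  by (simp add: truth_fm_def)

lemma fm_sat_foldr_Conj: "fm_sat D s (foldr Conj \<phi>s \<psi>) = ((\<forall>\<phi> \<in> set \<phi>s. fm_sat D s \<phi>) \<and> fm_sat D s \<psi>)"
  by (induction \<phi>s) auto

lemma fm_wf_foldr_Conj: "fm_wf VD (foldr Conj \<phi>s \<psi>) = ((\<forall>\<phi> \<in> set \<phi>s. fm_wf VD \<phi>) \<and> fm_wf VD \<psi>)"
  by (induction \<phi>s) auto

lemma fm_fv_foldr_Conj: "fm_fv (foldr Conj \<phi>s \<psi>) = \<Union>(fm_fv ` set \<phi>s) \<union> fm_fv \<psi>"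
  by (induction \<phi>s) auto

lemma tm_eval_dtm_shift:
  assumes "set (dtm_mus t) \<subseteq> set ts" "\<And>u. u \<in> set ts \<Longrightarrow> s (position ts u) = \<nu> (tm_eval T n u)"
  shows "tm_eval D s (dtm_shift ts t) = dtm_eval D T \<nu> n (\<lambda>x. s (x + length ts)) t"
  using assms(1)
proof (induction t)
  case (DApp g us)
  then have "map (tm_eval D s \<circ> dtm_shift ts) us = map (dtm_eval D T \<nu> n (\<lambda>x. s (x + length ts))) us"
    by auto
  then show ?case
    by (simp del: map_eq_conv)
qed (use assms(2) in auto)

text \<open>The environment \<open>s\<close> carries two things: below \<open>length ts\<close> the
  values of the node terms, and from there on the data environment of the original formula. The
  induction runs over all \<open>s\<close>, because a data quantifier changes the second part and
  leaves the first intact.\<close>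

lemma fm_sat_data_part:
  assumes "node_qfree \<phi>" "set (afm_mus \<phi>) \<subseteq> set ts" "set ls = locs C"
    and "\<And>u. u \<in> set ts \<Longrightarrow> s (position ts u) = \<nu> (tm_eval T n u)"
  shows "fm_sat D s (data_part ls T loc ts n l \<phi>) =
    afm_sat D C T (loc, \<nu>) n (\<lambda>x. s (x + length ts)) l \<phi>"
  using assms(1,2,4)
proof (induction \<phi> arbitrary: s l)
  case (AEqD t u)
  then show ?case
    by (simp add: tm_eval_dtm_shift[where \<nu> = \<nu> and T = T and n = n])
next
  case (APredD q us)
  have "tm_eval D s (dtm_shift ts u) = dtm_eval D T \<nu> n (\<lambda>x. s (x + length ts)) u" if "u \<in> set us" for u
    using APredD that by (intro tm_eval_dtm_shift) auto
  then have "map (tm_eval D s \<circ> dtm_shift ts) us = map (dtm_eval D T \<nu> n (\<lambda>x. s (x + length ts))) us"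
    by auto
  then show ?case
    by (simp del: map_eq_conv)
next
  case (AAllD x \<phi>)
  have "fm_sat D (s(x + length ts := a)) (data_part ls T loc ts n l \<phi>) =
      afm_sat D C T (loc, \<nu>) n ((\<lambda>y. s (y + length ts))(x := a)) l \<phi>" for a
  proof -
    have "(\<lambda>y. (s(x + length ts := a)) (y + length ts)) = (\<lambda>y. s (y + length ts))(x := a)"
      by auto
    moreover have "(s(x + length ts := a)) (position ts u) = \<nu> (tm_eval T n u)" if "u \<in> set ts" for u
      using AAllD.prems(3)[OF that] position_less[OF that] by simp
    ultimately show ?thesis
      using AAllD.IH[of "s(x + length ts := a)" l] AAllD.prems(1,2)
      unfolding node_qfree.simps afm_mus.simps by presburger
  qed
  then show ?case
    by simp
next
  case (AAllL x \<phi>)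
  have "fm_sat D s (data_part ls T loc ts n (l(x := c)) \<phi>) =
      afm_sat D C T (loc, \<nu>) n (\<lambda>y. s (y + length ts)) (l(x := c)) \<phi>" for c
    using AAllL.prems by (intro AAllL.IH) auto
  then show ?case
    using assms(3) by (simp add: fm_sat_foldr_Conj)
qed auto

lemma tm_wf_dtm_shift: "dtm_wf VN VD t \<Longrightarrow> tm_wf VD (dtm_shift ts t)"
  by (induction t) auto

lemma fm_wf_data_part: "afm_wf VN VD C \<phi> \<Longrightarrow> fm_wf VD (data_part ls T loc ts n l \<phi>)"
  by (induction \<phi> arbitrary: l) (auto simp: fm_wf_foldr_Conj truth_fm_def tm_wf_dtm_shift)

lemma tm_vars_dtm_shift:
  "set (dtm_mus t) \<subseteq> set ts \<Longrightarrow>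
    tm_vars (dtm_shift ts t) \<subseteq> {..<length ts} \<union> (\<lambda>x. x + length ts) ` dtm_dvars t"
proof (induction t)
  case (DApp g us)
  then have "tm_vars (dtm_shift ts u) \<subseteq> {..<length ts} \<union> (\<lambda>x. x + length ts) ` dtm_dvars u"
    if "u \<in> set us" for u
    using that by auto
  then show ?case
    by fastforce
qed (auto simp: position_less)

lemma fm_fv_data_part:
  "set (afm_mus \<phi>) \<subseteq> set ts \<Longrightarrow>
    fm_fv (data_part ls T loc ts n l \<phi>) \<subseteq> {..<length ts} \<union> (\<lambda>x. x + length ts) ` afm_dfv \<phi>"
proof (induction \<phi> arbitrary: l)
  case (AEqD t u)
  then show ?case
    using tm_vars_dtm_shift[of t ts] tm_vars_dtm_shift[of u ts] by auto
next
  case (APredD q us)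
  then have "tm_vars (dtm_shift ts u) \<subseteq> {..<length ts} \<union> (\<lambda>x. x + length ts) ` dtm_dvars u"
    if "u \<in> set us" for u
    using that by (intro tm_vars_dtm_shift) auto
  then show ?case
    by fastforce
next
  case (AAllD x \<phi>)
  then have "fm_fv (data_part ls T loc ts n l \<phi>) \<subseteq> {..<length ts} \<union> (\<lambda>x. x + length ts) ` afm_dfv \<phi>"
    by simp
  then show ?case
    by auto
next
  case (AAllL x \<phi>)
  then have "fm_fv (data_part ls T loc ts n l \<phi>) \<subseteq> {..<length ts} \<union> (\<lambda>x. x + length ts) ` afm_dfv \<phi>" for l
    by simp
  then show ?case
    by (auto simp: fm_fv_foldr_Conj truth_fm_def)
next
  case (AConj \<phi> \<psi>)
  then have "fm_fv (data_part ls T loc ts n l \<phi>) \<subseteq> {..<length ts} \<union> (\<lambda>x. x + length ts) ` afm_dfv \<phi>"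
    "fm_fv (data_part ls T loc ts n l \<psi>) \<subseteq> {..<length ts} \<union> (\<lambda>x. x + length ts) ` afm_dfv \<psi>"
    by auto
  then show ?case
    by auto
qed (auto simp: truth_fm_def)

text \<open>Equality, not mere equivalence, is what sequencing requires. Atoms about nodes and
  locations have the same truth value on both sides, by injectivity of \<open>f\<close> for
  equations between nodes; data atoms retain only positions in \<open>ts\<close>, which do not
  depend on the topology.\<close>

lemma data_part_embedding:
  assumes f: "embeds_on VN (univ S) S T f" and S: "fclosed VN S (univ S)"
    and n: "n ` W \<subseteq> univ S" "\<And>x. x \<in> W \<Longrightarrow> n' x = f (n x)"
    and loc: "\<And>v. v \<in> univ S \<Longrightarrow> loc' v = loc (f v)"
    and \<phi>: "node_qfree \<phi>" "afm_wf VN VD C \<phi>" "afm_nfv \<phi> \<subseteq> W"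
  shows "data_part ls T loc ts n' l \<phi> = data_part ls S loc' ts n l \<phi>"
proof -
  have tm: "tm_eval S n t \<in> univ S \<and> tm_eval T n' t = f (tm_eval S n t)"
    if "tm_wf VN t" "tm_vars t \<subseteq> W" for t
    using tm_eval_in[OF S that(1), of n] tm_eval_embeds_on[OF f S that(1), of n n'] that(2) n by auto
  have inj: "inj_on f (univ S)"
    using f by (simp add: embeds_on_def)
  show ?thesis
    using \<phi>
  proof (induction \<phi> arbitrary: l)
    case (AEqN t u)
    then have "tm_eval T n' t = tm_eval T n' u \<longleftrightarrow> tm_eval S n t = tm_eval S n u"
      using tm[of t] tm[of u] inj_on_eq_iff[OF inj] by simp
    then show ?case
      by simp
  next
    case (AEqL t u)
    have "ltm_eval T loc n' l t = ltm_eval S loc' n l t" if "ltm_wf VN C t" "ltm_nvars t \<subseteq> W" for t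
      using that tm loc by (cases t) auto
    with AEqL show ?case
      by simp
  next
    case (APredN p us)
    then have "map (tm_eval T n') us = map f (map (tm_eval S n) us)" "set (map (tm_eval S n) us) \<subseteq> univ S"
      using tm by (auto simp: UN_subset_iff)
    then show ?case
      using APredN.prems f by (simp add: embeds_on_def del: map_map map_eq_conv set_map)
  qed auto
qed

lemma afm_mus_wf:
  assumes "node_qfree \<phi>" "afm_wf VN VD C \<phi>" "t \<in> set (afm_mus \<phi>)"
  shows "tm_wf VN t \<and> tm_vars t \<subseteq> afm_nfv \<phi>"
proof -
  have dtm: "tm_wf VN t \<and> tm_vars t \<subseteq> dtm_nvars u" if "dtm_wf VN VD u" "t \<in> set (dtm_mus u)" for u
    using that by (induction u) fastforce+
  show ?thesis
    using assms
  proof (induction \<phi>)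
    case (AEqD u v)
    then show ?case
      using dtm[of u] dtm[of v] by auto
  next
    case (APredD q us)
    then show ?case
      using dtm by fastforce
  qed auto
qed

section \<open>Environments and blocks of node quantifiers\<close>

lemma afm_sat_cong:
  assumes "\<And>x. x \<in> afm_nfv \<phi> \<Longrightarrow> n x = n' x" "\<And>x. x \<in> afm_dfv \<phi> \<Longrightarrow> d x = d' x"
    "\<And>x. x \<in> afm_lfv \<phi> \<Longrightarrow> l x = l' x"
  shows "afm_sat D C T st n d l \<phi> = afm_sat D C T st n' d' l' \<phi>"
proof -
  have dtm: "dtm_eval D T \<nu> n d t = dtm_eval D T \<nu> n' d' t"
    if "\<And>x. x \<in> dtm_nvars t \<Longrightarrow> n x = n' x" "\<And>x. x \<in> dtm_dvars t \<Longrightarrow> d x = d' x" for \<nu> n n' d d' t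
    using that
  proof (induction t)
    case (DApp g us)
    have "dtm_eval D T \<nu> n d u = dtm_eval D T \<nu> n' d' u" if "u \<in> set us" for u
      using that DApp.prems by (intro DApp.IH) auto
    then show ?case
      by (simp cong: map_cong)
  next
    case (Mu t)
    then show ?case
      using tm_eval_cong[of t n n' T] by simp
  qed simp
  have ltm: "ltm_eval T loc n l t = ltm_eval T loc n' l' t"
    if "\<And>x. x \<in> ltm_nvars t \<Longrightarrow> n x = n' x" "\<And>x. x \<in> ltm_lvars t \<Longrightarrow> l x = l' x" for loc n n' l l' t
    using that tm_eval_cong[of _ n n' T] by (cases t) auto
  show ?thesis
    using assms
  proof (induction \<phi> arbitrary: n n' d d' l l')
    case (AEqN t u)
    then show ?case
      using tm_eval_cong[of t n n' T] tm_eval_cong[of u n n' T] by simp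
  next
    case (AEqD t u)
    then show ?case
      using dtm[of t n n' d d'] dtm[of u n n' d d'] by simp
  next
    case (AEqL t u)
    then show ?case
      using ltm[of t n n' l l'] ltm[of u n n' l l'] by simp
  next
    case (APredN p us)
    have "tm_eval T n u = tm_eval T n' u" if "u \<in> set us" for u
      using that APredN.prems by (intro tm_eval_cong) auto
    then show ?case
      by (simp cong: map_cong)
  next
    case (APredD p us)
    have "dtm_eval D T (snd st) n d u = dtm_eval D T (snd st) n' d' u" if "u \<in> set us" for u
      using that APredD.prems by (intro dtm) auto
    then show ?case
      by (simp cong: map_cong)
  next
    case (ANeg \<phi>)
    have "afm_sat D C T st n d l \<phi> = afm_sat D C T st n' d' l' \<phi>"
      using ANeg.prems by (intro ANeg.IH) auto
    then show ?case
      by simp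
  next
    case (AConj \<phi> \<psi>)
    have "afm_sat D C T st n d l \<phi> = afm_sat D C T st n' d' l' \<phi>"
      using AConj.prems by (intro AConj.IH(1)) auto
    moreover have "afm_sat D C T st n d l \<psi> = afm_sat D C T st n' d' l' \<psi>"
      using AConj.prems by (intro AConj.IH(2)) auto
    ultimately show ?case
      by simp
  next
    case (AAllN x \<phi>)
    have "afm_sat D C T st (n(x := a)) d l \<phi> = afm_sat D C T st (n'(x := a)) d' l' \<phi>" for a
      using AAllN.prems by (intro AAllN.IH) auto
    then show ?case
      by simp
  next
    case (AAllD x \<phi>)
    have "afm_sat D C T st n (d(x := a)) l \<phi> = afm_sat D C T st n' (d'(x := a)) l' \<phi>" for a
      using AAllD.prems by (intro AAllD.IH) auto
    then show ?case
      by simp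
  next
    case (AAllL x \<phi>)
    have "afm_sat D C T st n d (l(x := a)) \<phi> = afm_sat D C T st n' d' (l'(x := a)) \<phi>" for a
      using AAllL.prems by (intro AAllL.IH) auto
    then show ?case
      by simp
  qed simp
qed

lemma afm_sat_foldr_AAllN:
  "afm_sat D C T st n d l (foldr AAllN us \<phi>) \<longleftrightarrow>
    (\<forall>n'. n' ` set us \<subseteq> univ T \<and> (\<forall>x. x \<notin> set us \<longrightarrow> n' x = n x) \<longrightarrow> afm_sat D C T st n' d l \<phi>)"
proof (induction us arbitrary: n)
  case Nil
  have "n' = n" if "\<forall>x. n' x = n x" for n'
    using that by auto
  then show ?case
    by auto
next
  case (Cons u us)
  show ?case (is "?L \<longleftrightarrow> ?R")
  proof
    assume L: ?L
    show ?R
    proof (intro allI impI)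
      fix n' assume n': "n' ` set (u # us) \<subseteq> univ T \<and> (\<forall>x. x \<notin> set (u # us) \<longrightarrow> n' x = n x)"
      then have "afm_sat D C T st (n(u := n' u)) d l (foldr AAllN us \<phi>)"
        using L by simp
      with n' show "afm_sat D C T st n' d l \<phi>"
        unfolding Cons.IH by simp
    qed
  next
    assume R: ?R
    show ?L
      unfolding foldr_Cons o_apply afm_sat.simps Cons.IH
    proof (intro ballI allI impI)
      fix a n' assume "a \<in> univ T" "n' ` set us \<subseteq> univ T \<and> (\<forall>x. x \<notin> set us \<longrightarrow> n' x = (n(u := a)) x)"
      \<comment> \<open>If \<open>u\<close> recurs in \<open>us\<close>, its value is set by an
        inner quantifier instead of by \<open>a\<close>.\<close>
      then have "n' ` set (u # us) \<subseteq> univ T \<and> (\<forall>x. x \<notin> set (u # us) \<longrightarrow> n' x = n x)"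
        by (cases "u \<in> set us") auto
      then show "afm_sat D C T st n' d l \<phi>"
        using R by blast
    qed
  qed
qed

text \<open>The extensional functions on \<open>set us\<close> are exactly the environments that the
  quantifier block reaches from the \<open>undefined\<close> environment of
  \<open>state_sat\<close>; over a finite topology there are finitely many of them.\<close>

lemma state_sat_foldr_AAllN:
  assumes "afm_nfv \<phi> \<subseteq> set us" "afm_dfv \<phi> = {}" "afm_lfv \<phi> = {}"
  shows "state_sat D C T st (foldr AAllN us \<phi>) \<longleftrightarrow>
    (\<forall>n \<in> set us \<rightarrow>\<^sub>E univ T. afm_sat D C T st n d l \<phi>)"
  unfolding state_sat_def afm_sat_foldr_AAllN
proof (intro iffI ballI allI impI)
  fix n assume L: "\<forall>n'. n' ` set us \<subseteq> univ T \<and> (\<forall>x. x \<notin> set us \<longrightarrow> n' x = undefined) \<longrightarrow>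
      afm_sat D C T st n' (\<lambda>_. undefined) (\<lambda>_. undefined) \<phi>"
    and "n \<in> set us \<rightarrow>\<^sub>E univ T"
  then have "n ` set us \<subseteq> univ T \<and> (\<forall>x. x \<notin> set us \<longrightarrow> n x = undefined)"
    by (auto simp: PiE_iff extensional_def)
  with L have "afm_sat D C T st n (\<lambda>_. undefined) (\<lambda>_. undefined) \<phi>"
    by blast
  then show "afm_sat D C T st n d l \<phi>"
    by (subst afm_sat_cong[where n' = n and d' = "\<lambda>_. undefined" and l' = "\<lambda>_. undefined"])
      (use assms in auto)
next
  fix n assume R: "\<forall>n \<in> set us \<rightarrow>\<^sub>E univ T. afm_sat D C T st n d l \<phi>"
    and "n ` set us \<subseteq> univ T \<and> (\<forall>x. x \<notin> set us \<longrightarrow> n x = undefined)"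
  then have "n \<in> set us \<rightarrow>\<^sub>E univ T"
    by (auto simp: PiE_iff extensional_def)
  with R have "afm_sat D C T st n d l \<phi>"
    by blast
  then show "afm_sat D C T st n (\<lambda>_. undefined) (\<lambda>_. undefined) \<phi>"
    by (subst afm_sat_cong[where n' = n and d' = d and l' = l]) (use assms in auto)
qed

section \<open>The generating triples\<close>

text \<open>The basis is given by indices \<open>J\<close> because the generators use
  \<open>P j\<close> and \<open>e j\<close>, which are attached to indices rather than to
  topologies. The list \<open>ls\<close> enumerates the locations, for the expansion of location
  quantifiers; the width is \<open>length us\<close>.\<close>

locale ashcroft_setting =
  fixes VN :: "('f, 'p) vocab" and VD :: "('g, 'q) vocab"
    and D :: "('g, 'q, 'd) fostruct" and C :: "('c, 'l) control"
    and I :: "'i set" and T :: "'i \<Rightarrow> ('f, 'p, 'v) fostruct"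
    and P :: "'i \<Rightarrow> ('c, 'v, 'd) program"
    and U :: "('f, 'p, 'u) fostruct" and e :: "'i \<Rightarrow> 'v \<Rightarrow> 'u"
    and us :: "nat list" and \<phi> :: "('f, 'p, 'g, 'q, 'l) afm" and ls :: "'l list" and J :: "'i set"
  assumes D: "is_struct VD D"
    and C: "is_control C"
    and PP: "parameterized_program VN D C I T P"
    and U: "universal_structure VN I T U e"
    and qf: "qf_ashcroft VN VD C \<phi>" "afm_nfv \<phi> \<subseteq> set us"
    and inv: "\<And>i. i \<in> I \<Longrightarrow> ashcroft_invariant VN D C (T i) (P i) (foldr AAllN us \<phi>)"
    and ls: "set ls = locs C"
    and J: "finite J" "J \<subseteq> I" "\<And>j. j \<in> J \<Longrightarrow> finite (univ (T j))"
    and basis: "is_basis VN (length us + 1) (T ` I) (T ` J)"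
begin

text \<open>The list of \<mu>-terms is read off \<open>\<phi>\<close> alone, so a free variable
  stands for the same term in every topology.\<close>

definition conjunct ::
  "('f, 'p, 'w) fostruct \<Rightarrow> ('w \<Rightarrow> 'l) \<Rightarrow> (nat \<Rightarrow> 'w) \<Rightarrow> ('g, 'q) fm \<times> 'w list" where
  "conjunct A loc n =
     (data_part ls A loc (afm_mus \<phi>) n (\<lambda>_. undefined) \<phi>, map (tm_eval A n) (afm_mus \<phi>))"

definition node_envs :: "'i \<Rightarrow> (nat \<Rightarrow> 'v) set" where
  "node_envs j = (set us \<rightarrow>\<^sub>E univ (T j))"

text \<open>Assertions are lists, so some enumeration has to be fixed. It is meaningful for
  \<open>j \<in> J\<close>, where the environments are finitely many.\<close>

definition env_list :: "'i \<Rightarrow> (nat \<Rightarrow> 'v) list" where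
  "env_list j = (SOME ns. set ns = node_envs j)"

text \<open>At a fixed location map this conjunction expresses the whole invariant over
  \<open>T j\<close>; finiteness of the basis topologies is what makes it an assertion.\<close>

definition inv_assn :: "'i \<Rightarrow> ('v \<Rightarrow> 'l) \<Rightarrow> ('g, 'q, 'v) assertion" where
  "inv_assn j loc = map (conjunct (T j) loc) (env_list j)"

text \<open>The empty precondition is right because the initial location map satisfies the invariant
  under every valuation.\<close>

definition init_triples :: "'i \<Rightarrow> ('g, 'q, 'c, 'v) triple set" where
  "init_triples j = (\<lambda>n. ([], [], [conjunct (T j) (init_loc C (T j)) n])) ` node_envs j"

text \<open>The precondition collects all instances because only the invariant as a whole is
  inductive. The postcondition is a single instance because different instances after a step may be
  covered by different basis topologies.\<close>

definition step_triples :: "'i \<Rightarrow> ('g, 'q, 'c, 'v) triple set" where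
  "step_triples j = (\<lambda>(loc, \<sigma>, v, n). (inv_assn j loc, [(\<sigma>, v)], [conjunct (T j) (loc(v := tgt C \<sigma>)) n])) `
     {(loc, \<sigma>, v, n). loc \<in> univ (T j) \<rightarrow>\<^sub>E locs C \<and> v \<in> univ (T j) \<and> \<sigma> \<in> enabled (P j) v \<and>
       loc v = src C \<sigma> \<and> n \<in> node_envs j}"

text \<open>The precondition is unsatisfiable, as a state satisfying the invariant has no node at
  the error location. These triples close an error run in place of a consequence rule.\<close>

definition error_triples :: "'i \<Rightarrow> ('g, 'q, 'c, 'v) triple set" where
  "error_triples j = (\<lambda>loc. (inv_assn j loc, [], bot_assn)) `
     {loc. loc \<in> univ (T j) \<rightarrow>\<^sub>E locs C \<and> lerr C \<in> loc ` univ (T j)}"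

definition generators :: "('g, 'q, 'c, 'u) triple set" where
  "generators = (\<Union>j \<in> J. map_triple (e j) ` (init_triples j \<union> step_triples j \<union> error_triples j))"

section \<open>Finiteness and well-formedness of the generators, meaning of the conjuncts\<close>

lemma T_struct: "i \<in> I \<Longrightarrow> is_struct VN (T i)"
  using PP by (simp add: parameterized_program_def)

lemma T_nonempty: "i \<in> I \<Longrightarrow> univ (T i) \<noteq> {}"
  using T_struct by (auto simp: is_struct_def)

lemma enabled_cmds: "i \<in> I \<Longrightarrow> v \<in> univ (T i) \<Longrightarrow> enabled (P i) v \<subseteq> cmds C"
  using PP by (simp add: parameterized_program_def is_program_def)

lemma D_nonempty: "univ D \<noteq> {}"
  using D by (simp add: is_struct_def)

lemma loc_update:
  assumes "i \<in> I" "loc \<in> univ (T i) \<rightarrow>\<^sub>E locs C" "v \<in> univ (T i)" "\<sigma> \<in> enabled (P i) v"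
  shows "loc(v := tgt C \<sigma>) \<in> univ (T i) \<rightarrow>\<^sub>E locs C"
proof -
  have "tgt C \<sigma> \<in> locs C"
    using C enabled_cmds[OF assms(1,3)] assms(4) by (auto simp: is_control_def)
  then show ?thesis
    using assms(2,3) by (auto simp: PiE_iff extensional_def)
qed

lemma finite_node_envs: "j \<in> J \<Longrightarrow> finite (node_envs j)"
  unfolding node_envs_def by (intro finite_PiE J) auto

lemma set_env_list: "j \<in> J \<Longrightarrow> set (env_list j) = node_envs j"
  unfolding env_list_def using finite_list[OF finite_node_envs] by (rule someI_ex)

lemma finite_generators: "finite generators"
proof -
  have "finite (step_triples j)" if j: "j \<in> J" for j
  proof -
    have "finite ((univ (T j) \<rightarrow>\<^sub>E locs C) \<times> cmds C \<times> univ (T j) \<times> node_envs j)"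
      using C J(3)[OF j] finite_node_envs[OF j]
      by (intro finite_cartesian_product finite_PiE) (auto simp: is_control_def)
    then show ?thesis
      unfolding step_triples_def
      by (intro finite_imageI, elim rev_finite_subset) (use enabled_cmds J(2) j in fastforce)
  qed
  moreover have "finite (error_triples j)" if j: "j \<in> J" for j
  proof -
    have "finite (univ (T j) \<rightarrow>\<^sub>E locs C)"
      using C J(3)[OF j] by (intro finite_PiE) (auto simp: is_control_def)
    then show ?thesis
      unfolding error_triples_def by (intro finite_imageI, elim rev_finite_subset) auto
  qed
  ultimately show ?thesis
    using J(1) finite_node_envs by (auto simp: generators_def init_triples_def)
qed

lemma tm_eval_mus:
  assumes "i \<in> I" "n ` set us \<subseteq> univ (T i)" "t \<in> set (afm_mus \<phi>)"
  shows "tm_eval (T i) n t \<in> univ (T i)"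
proof -
  have "tm_wf VN t" "tm_vars t \<subseteq> set us"
    using afm_mus_wf[of \<phi> VN VD C t] assms(3) qf by (auto simp: qf_ashcroft_def)
  then show ?thesis
    using assms(2) tm_eval_in[OF fclosed_univ[OF T_struct[OF assms(1)]], of t n] by blast
qed

lemma conjunct_wf:
  assumes "i \<in> I" "n ` set us \<subseteq> univ (T i)"
  shows "assn_wf VD (T i) [conjunct (T i) loc n]"
proof -
  let ?\<psi> = "data_part ls (T i) loc (afm_mus \<phi>) n (\<lambda>_. undefined) \<phi>"
  have "fm_wf VD ?\<psi>" "fm_fv ?\<psi> \<subseteq> {..<length (afm_mus \<phi>)}"
    using fm_wf_data_part[of VN VD C \<phi>] fm_fv_data_part[of \<phi> "afm_mus \<phi>"] qf(1)
    by (simp_all add: qf_ashcroft_def)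
  then show ?thesis
    using tm_eval_mus[OF assms] by (auto simp: assn_wf_def conjunct_def)
qed

lemma conjunct_sat:
  assumes "i \<in> I"
  shows "assn_sat D \<nu> [conjunct (T i) loc n] \<longleftrightarrow>
    afm_sat D C (T i) (loc, \<nu>) n (\<lambda>_. undefined) (\<lambda>_. undefined) \<phi>"
proof -
  let ?s = "\<lambda>j. \<nu> (map (tm_eval (T i) n) (afm_mus \<phi>) ! j)"
  have "?s (position (afm_mus \<phi>) u) = \<nu> (tm_eval (T i) n u)" if "u \<in> set (afm_mus \<phi>)" for u
    using position_less[OF that] nth_position[OF that] by simp
  then have "assn_sat D \<nu> [conjunct (T i) loc n] \<longleftrightarrow>
      afm_sat D C (T i) (loc, \<nu>) n (\<lambda>x. ?s (x + length (afm_mus \<phi>))) (\<lambda>_. undefined) \<phi>"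
    using qf(1) ls fm_sat_data_part[of \<phi> "afm_mus \<phi>" ls C ?s \<nu> "T i" n D loc "\<lambda>_. undefined"]
    by (simp add: assn_sat_def conjunct_def qf_ashcroft_def)
  \<comment> \<open>Past the end of the node list the environment \<open>?s\<close> is arbitrary; it
    may be replaced since \<open>\<phi>\<close> has no free data variables.\<close>
  also have "\<dots> \<longleftrightarrow> afm_sat D C (T i) (loc, \<nu>) n (\<lambda>_. undefined) (\<lambda>_. undefined) \<phi>"
    using qf(1) by (intro afm_sat_cong) (auto simp: qf_ashcroft_def)
  finally show ?thesis .
qed

lemma state_sat_iff:
  assumes "i \<in> I"
  shows "state_sat D C (T i) (loc, \<nu>) (foldr AAllN us \<phi>) \<longleftrightarrow>
    (\<forall>n \<in> node_envs i. assn_sat D \<nu> [conjunct (T i) loc n])"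
  unfolding conjunct_sat[OF assms] node_envs_def
  using qf by (intro state_sat_foldr_AAllN) (auto simp: qf_ashcroft_def)

lemma inv_assn_sat:
  assumes "j \<in> J"
  shows "assn_sat D \<nu> (inv_assn j loc) \<longleftrightarrow> state_sat D C (T j) (loc, \<nu>) (foldr AAllN us \<phi>)"
  using assms J(2) by (subst state_sat_iff) (auto simp: assn_sat_def inv_assn_def set_env_list)

lemma node_envs_image: "n \<in> node_envs i \<Longrightarrow> n ` set us \<subseteq> univ (T i)"
  by (auto simp: node_envs_def)

lemma inv_assn_wf:
  assumes "j \<in> J"
  shows "assn_wf VD (T j) (inv_assn j loc)"
  using conjunct_wf[of j _ loc] J(2) assms node_envs_image
  by (fastforce simp: assn_wf_def inv_assn_def set_env_list)

lemma generator_triples: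
  assumes "j \<in> J"
  shows "init_triples j \<union> step_triples j \<union> error_triples j \<subseteq> triples VD C (T j)"
proof -
  have j: "j \<in> I"
    using assms J(2) by auto
  have "\<sigma> \<in> cmds C" if "v \<in> univ (T j)" "\<sigma> \<in> enabled (P j) v" for \<sigma> v
    using enabled_cmds[OF j] that by blast
  moreover have "assn_wf VD (T j) []" "assn_wf VD (T j) bot_assn"
    by (auto simp: assn_wf_def bot_assn_def)
  ultimately show ?thesis
    using inv_assn_wf[OF assms] conjunct_wf[OF j node_envs_image]
    by (auto simp: triples_def init_triples_def step_triples_def error_triples_def)
qed

section \<open>Validity of the generators\<close>

lemma init_triples_valid:
  assumes "j \<in> I" "(A, \<rho>, B) \<in> init_triples j"
    and "(\<nu>, \<nu>') \<in> global_word VN D (T j) (psem (P j)) (univ (T j)) \<rho>"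
  shows "assn_sat D \<nu>' B"
proof -
  obtain n where n: "n \<in> node_envs j" "\<rho> = []" "B = [conjunct (T j) (init_loc C (T j)) n]"
    using assms(2) by (auto simp: init_triples_def)
  have "(init_loc C (T j), \<nu>') \<in> states D C (T j)"
    using assms(3) n(2) C by (auto simp: states_def init_loc_def is_control_def)
  then have "state_sat D C (T j) (init_loc C (T j), \<nu>') (foldr AAllN us \<phi>)"
    using inv[OF assms(1)] by (auto simp: ashcroft_invariant_def)
  then show ?thesis
    using n state_sat_iff[OF assms(1)] by blast
qed

lemma step_triples_valid:
  assumes "j \<in> J" "(A, \<rho>, B) \<in> step_triples j"
    and "(\<nu>, \<nu>') \<in> global_word VN D (T j) (psem (P j)) (univ (T j)) \<rho>" "assn_sat D \<nu> A"
  shows "assn_sat D \<nu>' B"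
proof -
  have j: "j \<in> I"
    using assms(1) J(2) by auto
  obtain loc \<sigma> v n where *: "A = inv_assn j loc" "\<rho> = [(\<sigma>, v)]"
    "B = [conjunct (T j) (loc(v := tgt C \<sigma>)) n]" "loc \<in> univ (T j) \<rightarrow>\<^sub>E locs C" "v \<in> univ (T j)"
    "\<sigma> \<in> enabled (P j) v" "loc v = src C \<sigma>" "n \<in> node_envs j"
    using assms(2) by (auto simp: step_triples_def)
  have step: "(\<nu>, \<nu>') \<in> global VN D (T j) (psem (P j)) (univ (T j)) (\<sigma>, v)"
    using assms(3) *(2) by auto
  then have "(loc, \<nu>) \<in> states D C (T j)" "(loc(v := tgt C \<sigma>), \<nu>') \<in> states D C (T j)"
    using *(4) loc_update[OF j *(4-6)] by (auto simp: states_def global_def)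
  moreover have "state_step VN D C (T j) (P j) (loc, \<nu>) (loc(v := tgt C \<sigma>), \<nu>')"
    unfolding state_step_def using step *(5-7)
    by (intro exI[of _ "(\<sigma>, v)"]) (simp add: loc_step_def)
  moreover have "state_sat D C (T j) (loc, \<nu>) (foldr AAllN us \<phi>)"
    using assms(4) *(1) inv_assn_sat[OF assms(1)] by blast
  ultimately have "state_sat D C (T j) (loc(v := tgt C \<sigma>), \<nu>') (foldr AAllN us \<phi>)"
    using inv[OF j] unfolding ashcroft_invariant_def by blast
  then show ?thesis
    using *(3,8) state_sat_iff[OF j] by blast
qed

lemma error_triples_valid:
  assumes "j \<in> J" "(A, \<rho>, B) \<in> error_triples j"
    and "(\<nu>, \<nu>') \<in> global_word VN D (T j) (psem (P j)) (univ (T j)) \<rho>"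
  shows "\<not> assn_sat D \<nu> A"
proof
  assume "assn_sat D \<nu> A"
  obtain loc v where *: "A = inv_assn j loc" "\<rho> = []" "loc \<in> univ (T j) \<rightarrow>\<^sub>E locs C"
    "v \<in> univ (T j)" "loc v = lerr C"
    using assms(2) by (auto simp: error_triples_def)
  have "(loc, \<nu>) \<in> states D C (T j)"
    using assms(3) *(2,3) by (auto simp: states_def)
  moreover have "state_sat D C (T j) (loc, \<nu>) (foldr AAllN us \<phi>)"
    using \<open>assn_sat D \<nu> A\<close> *(1) inv_assn_sat[OF assms(1)] by blast
  ultimately show False
    using *(4,5) inv[of j] assms(1) J(2) unfolding ashcroft_invariant_def by fastforce
qed

lemma generators_triples: "generators \<subseteq> triples VD C U"
proof -
  have "map_triple (e j) t \<in> triples VD C U"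
    if "j \<in> J" "t \<in> init_triples j \<union> step_triples j \<union> error_triples j" for j t
  proof (rule map_triple_in_triples)
    show "t \<in> triples VD C (T j)"
      using generator_triples that by blast
    show "e j ` univ (T j) \<subseteq> univ U"
      using U J(2) that(1) by (auto simp: universal_structure_def embedding_iff_embeds_on)
  qed
  then show ?thesis
    by (auto simp: generators_def)
qed

lemma generators_valid:
  assumes "h \<in> generators"
  shows "triple_valid VN D U (usem VN I T P U) h"
proof -
  obtain j A \<rho> B where *: "j \<in> J" "h = map_triple (e j) (A, \<rho>, B)"
    "(A, \<rho>, B) \<in> init_triples j \<union> step_triples j \<union> error_triples j"
    using assms unfolding generators_def by fast
  have j: "j \<in> I"
    using *(1) J(2) by auto
  show ?thesis
    unfolding *(2)
  proof (rule triple_valid_map_triple[OF PP U j D_nonempty])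
    show "(A, \<rho>, B) \<in> triples VD C (T j)"
      using generator_triples[OF *(1)] *(3) by blast
    show "assn_sat D \<nu>' B"
      if "(\<nu>, \<nu>') \<in> global_word VN D (T j) (psem (P j)) (univ (T j)) \<rho>" "assn_sat D \<nu> A" for \<nu> \<nu>'
      using *(3) that init_triples_valid[OF j] step_triples_valid[OF *(1)] error_triples_valid[OF *(1)]
      by blast
  qed
qed

section \<open>Derivation of the error runs\<close>

lemma conjunct_embedding:
  assumes "j \<in> I" "embedding VN (T j) A f" "n ` set us \<subseteq> univ (T j)"
    "\<And>x. x \<in> set us \<Longrightarrow> n' x = f (n x)" "\<And>v. v \<in> univ (T j) \<Longrightarrow> loc' v = loc (f v)"
  shows "map_assn g [conjunct A loc n'] = map_assn (g \<circ> f) [conjunct (T j) loc' n]"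
proof -
  have S: "fclosed VN (T j) (univ (T j))"
    using T_struct[OF assms(1)] by (rule fclosed_univ)
  have f: "embeds_on VN (univ (T j)) (T j) A f"
    using assms(2) by (simp add: embedding_iff_embeds_on)
  have "data_part ls A loc (afm_mus \<phi>) n' (\<lambda>_. undefined) \<phi> =
      data_part ls (T j) loc' (afm_mus \<phi>) n (\<lambda>_. undefined) \<phi>"
    using qf assms(4,5)
    by (intro data_part_embedding[OF f S assms(3)]) (auto simp: qf_ashcroft_def)
  moreover have "tm_eval A n' t = f (tm_eval (T j) n t)" if "t \<in> set (afm_mus \<phi>)" for t
  proof -
    have "tm_wf VN t" "tm_vars t \<subseteq> set us"
      using afm_mus_wf[of \<phi> VN VD C t] that qf by (auto simp: qf_ashcroft_def)
    then show ?thesis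
      using assms(3,4) by (intro tm_eval_embeds_on[OF f S]) auto
  qed
  ultimately show ?thesis
    by (simp add: map_assn_def conjunct_def)
qed

lemma basis_cover:
  assumes "i \<in> I" "length as = length us + 1" "set as \<subseteq> univ (T i)"
  obtains j f where "j \<in> J" "embedding VN (T j) (T i) f" "set as \<subseteq> f ` univ (T j)"
  using basis assms unfolding is_basis_def by blast

text \<open>The generators speak about the copy of \<open>T j\<close> given by \<open>e j\<close>,
  while the run visits the copy inside \<open>T i\<close>. Both come from embeddings of
  \<open>T j\<close> into \<open>U\<close>, so S-param passes from one to the other.\<close>

lemma generator_transfer:
  assumes HH: "proof_space VN VD C U HH" "generators \<subseteq> HH" and "i \<in> I" "j \<in> J"
    "embedding VN (T j) (T i) f" "t \<in> init_triples j \<union> step_triples j \<union> error_triples j"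
  shows "map_triple (e i \<circ> f) t \<in> HH"
proof (rule s_param_closed_map_triple)
  have j: "j \<in> I"
    using assms(4) J(2) by auto
  show "s_param_closed VN U HH"
    using HH(1) by (simp add: proof_space_def)
  show "map_triple (e j) t \<in> HH"
    using HH(2) assms(4,6) unfolding generators_def by blast
  show "t \<in> triples VD C (T j)"
    using generator_triples[OF assms(4)] assms(6) by blast
  show "is_struct VN (T j)"
    using T_struct[OF j] .
  show "embedding VN (T j) U (e j)" "embedding VN (T j) U (e i \<circ> f)"
    using U j assms(3,5) by (auto simp: universal_structure_def intro: embedding_comp)
qed

text \<open>Empty preconditions concatenate to an empty one, so conjuncts can be collected freely.
  \<open>Bs\<close> must be nonempty, because no rule creates an empty postcondition from nonempty
  ones.\<close>

lemma conjunction_list: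
  assumes "conjunction_closed HH" "\<And>B. B \<in> set Bs \<Longrightarrow> ([], \<rho>, [B]) \<in> HH" "Bs \<noteq> []"
  shows "([], \<rho>, Bs) \<in> HH"
  using assms(3,2)
proof (induction Bs rule: list_nonempty_induct)
  case (cons B Bs)
  then have "([], \<rho>, [B]) \<in> HH" "([], \<rho>, Bs) \<in> HH"
    by auto
  then have "([] @ [], \<rho>, [B] @ Bs) \<in> HH"
    using assms(1) unfolding conjunction_closed_def by blast
  then show ?case
    by simp
qed auto

text \<open>Once both are renamed into \<open>U\<close>, the instance over \<open>T j\<close> at
  \<open>n\<close> is literally the instance over \<open>T i\<close> at \<open>f \<circ> n\<close>.
  So the invariant of the embedded basis topology is a conjunction of instances supplied by
  \<open>conj\<close>.\<close>

lemma inv_assn_derivable: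
  assumes HH: "proof_space VN VD C U HH" and i: "i \<in> I" and j: "j \<in> J"
    and f: "embedding VN (T j) (T i) f"
    and conj: "\<And>n. n ` set us \<subseteq> univ (T i) \<Longrightarrow> ([], \<rho>, map_assn (e i) [conjunct (T i) loc n]) \<in> HH"
  shows "([], \<rho>, map_assn (e i \<circ> f) (inv_assn j (restrict (loc \<circ> f) (univ (T j))))) \<in> HH"
proof (rule conjunction_list)
  have jI: "j \<in> I"
    using j J(2) by auto
  show "conjunction_closed HH"
    using HH by (simp add: proof_space_def)
  \<comment> \<open>Topologies are nonempty, so there is an environment; for width 0 it is the empty
    one.\<close>
  have "node_envs j \<noteq> {}"
    unfolding node_envs_def using T_nonempty[OF jI] by (simp add: PiE_eq_empty_iff)
  then show "map_assn (e i \<circ> f) (inv_assn j (restrict (loc \<circ> f) (univ (T j)))) \<noteq> []"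
    using set_env_list[OF j] by (auto simp: map_assn_def inv_assn_def)
  fix B assume "B \<in> set (map_assn (e i \<circ> f) (inv_assn j (restrict (loc \<circ> f) (univ (T j)))))"
  then obtain n where n: "n \<in> node_envs j"
    and B: "[B] = map_assn (e i \<circ> f) [conjunct (T j) (restrict (loc \<circ> f) (univ (T j))) n]"
    using set_env_list[OF j] by (auto simp: map_assn_def inv_assn_def)
  have "[B] = map_assn (e i) [conjunct (T i) loc (f \<circ> n)]"
    unfolding B using node_envs_image[OF n] by (intro conjunct_embedding[OF jI f, symmetric]) auto
  moreover have "(f \<circ> n) ` set us \<subseteq> univ (T i)"
    using node_envs_image[OF n] f by (auto simp: embedding_def)
  ultimately show "([], \<rho>, [B]) \<in> HH"
    using conj by simp
qed

lemma restrict_loc_PiE: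
  assumes "loc \<in> univ (T i) \<rightarrow>\<^sub>E locs C" "embedding VN (T j) (T i) f"
  shows "restrict (loc \<circ> f) (univ (T j)) \<in> univ (T j) \<rightarrow>\<^sub>E locs C"
proof -
  have "f x \<in> univ (T i)" if "x \<in> univ (T j)" for x
    using assms(2) that by (auto simp: embedding_def)
  then show ?thesis
    using assms(1) by auto
qed

text \<open>Induction on the prefix length, for all environments at once: one instance after a step
  rests on every instance before it that lives in the covering basis topology.\<close>

lemma conjunct_derivable:
  assumes HH: "proof_space VN VD C U HH" "generators \<subseteq> HH" and i: "i \<in> I"
    and \<Lambda>: "\<Lambda> 0 = init_loc C (T i)"
      "\<And>r. r < length \<rho> \<Longrightarrow> loc_step C (T i) (P i) (\<Lambda> r) (\<rho> ! r) (\<Lambda> (Suc r))"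
      "\<And>r. r \<le> length \<rho> \<Longrightarrow> \<Lambda> r \<in> univ (T i) \<rightarrow>\<^sub>E locs C"
    and n: "n ` set us \<subseteq> univ (T i)" and r: "r \<le> length \<rho>"
  shows "([], map_run (e i) (take r \<rho>), map_assn (e i) [conjunct (T i) (\<Lambda> r) n]) \<in> HH"
  using n r
proof (induction r arbitrary: n)
  case 0
  \<comment> \<open>No node moves yet; \<open>v\<close> pads the tuple to the length k + 1 that the
    basis covers.\<close>
  obtain v where v: "v \<in> univ (T i)"
    using T_nonempty[OF i] by auto
  obtain j f where j: "j \<in> J" and f: "embedding VN (T j) (T i) f"
    and cover: "set (map n us @ [v]) \<subseteq> f ` univ (T j)"
    by (rule basis_cover[OF i, of "map n us @ [v]"]) (use 0 v in auto)
  define m where "m = (\<lambda>x \<in> set us. inv_into (univ (T j)) f (n x))"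
  have m: "m \<in> node_envs j" "\<And>x. x \<in> set us \<Longrightarrow> n x = f (m x)"
    using cover by (auto simp: m_def node_envs_def inv_into_into f_inv_into_f)
  have "map_triple (e i \<circ> f) ([], [], [conjunct (T j) (init_loc C (T j)) m]) \<in> HH"
    using generator_transfer[OF HH i j f] m(1) unfolding init_triples_def by blast
  moreover have "map_assn (e i) [conjunct (T i) (\<Lambda> 0) n] =
      map_assn (e i \<circ> f) [conjunct (T j) (init_loc C (T j)) m]"
    using j J(2) f node_envs_image[OF m(1)] m(2)
    by (intro conjunct_embedding) (auto simp: \<Lambda>(1) init_loc_def embedding_def)
  ultimately show ?case
    by (simp add: map_triple_def map_run_def map_assn_def)
next
  case (Suc r)
  then have r: "r < length \<rho>"
    by simp
  obtain \<sigma> v where \<sigma>v: "\<rho> ! r = (\<sigma>, v)"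
    by fastforce
  have step: "v \<in> univ (T i)" "\<sigma> \<in> enabled (P i) v" "\<Lambda> r v = src C \<sigma>" "\<Lambda> (Suc r) = (\<Lambda> r)(v := tgt C \<sigma>)"
    using \<Lambda>(2)[OF r] by (auto simp: \<sigma>v loc_step_def)
  \<comment> \<open>The moving node is covered as well, so that the step is also a step of the basis
    topology.\<close>
  obtain j f where j: "j \<in> J" and f: "embedding VN (T j) (T i) f"
    and cover: "set (map n us @ [v]) \<subseteq> f ` univ (T j)"
    by (rule basis_cover[OF i, of "map n us @ [v]"]) (use Suc.prems step(1) in auto)
  have jI: "j \<in> I"
    using j J(2) by auto
  obtain w where w: "w \<in> univ (T j)" "v = f w"
    using cover by auto
  define m where "m = (\<lambda>x \<in> set us. inv_into (univ (T j)) f (n x))"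
  have m: "m \<in> node_envs j" "\<And>x. x \<in> set us \<Longrightarrow> n x = f (m x)"
    using cover by (auto simp: m_def node_envs_def inv_into_into f_inv_into_f)
  define loc where "loc = restrict (\<Lambda> r \<circ> f) (univ (T j))"
  have loc: "loc \<in> univ (T j) \<rightarrow>\<^sub>E locs C" "loc w = src C \<sigma>"
    using restrict_loc_PiE[OF \<Lambda>(3) f] r w step(3) by (auto simp: loc_def)
  \<comment> \<open>Enabled commands depend only on the local isomorphism type, so \<open>w\<close>
    may take the same step as \<open>v\<close>.\<close>
  have "local_iso VN (T j) [w] (T i) [v] f"
    using local_iso_embedding[OF T_struct[OF jI] f, of "[w]"] w by simp
  then have "enabled (P j) w = enabled (P i) v"
    using PP jI i w(1) step(1) unfolding parameterized_program_def by blast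
  then have "(inv_assn j loc, [(\<sigma>, w)], [conjunct (T j) (loc(w := tgt C \<sigma>)) m]) \<in> step_triples j"
    using loc w(1) step(2) m(1) unfolding step_triples_def by force
  then have "map_triple (e i \<circ> f) (inv_assn j loc, [(\<sigma>, w)], [conjunct (T j) (loc(w := tgt C \<sigma>)) m]) \<in> HH"
    by (intro generator_transfer[OF HH i j f]) blast
  moreover have "map_assn (e i) [conjunct (T i) (\<Lambda> (Suc r)) n] =
      map_assn (e i \<circ> f) [conjunct (T j) (loc(w := tgt C \<sigma>)) m]"
  proof (rule conjunct_embedding[OF jI f node_envs_image[OF m(1)] m(2)])
    fix x assume "x \<in> univ (T j)"
    \<comment> \<open>As \<open>f\<close> is injective, \<open>w\<close> is the only node of
      \<open>T j\<close> sent to \<open>v\<close>, so both location maps change at corresponding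
      nodes.\<close>
    moreover have "f x = f w \<longleftrightarrow> x = w" if "x \<in> univ (T j)"
      using f that w(1) by (auto simp: embedding_def inj_on_eq_iff)
    ultimately show "(loc(w := tgt C \<sigma>)) x = \<Lambda> (Suc r) (f x)"
      by (simp add: step(4) w(2) loc_def)
  qed
  ultimately have "(map_assn (e i \<circ> f) (inv_assn j loc), [(\<sigma>, e i v)],
      map_assn (e i) [conjunct (T i) (\<Lambda> (Suc r)) n]) \<in> HH"
    by (simp add: map_triple_def map_run_def w(2))
  moreover have "([], map_run (e i) (take r \<rho>), map_assn (e i \<circ> f) (inv_assn j loc)) \<in> HH"
    unfolding loc_def using Suc.IH r by (intro inv_assn_derivable[OF HH(1) i j f]) auto
  ultimately have "([], map_run (e i) (take r \<rho>) @ [(\<sigma>, e i v)],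
      map_assn (e i) [conjunct (T i) (\<Lambda> (Suc r)) n]) \<in> HH"
    using HH(1) unfolding proof_space_def sequencing_closed_def by blast
  moreover have "map_run (e i) (take (Suc r) \<rho>) = map_run (e i) (take r \<rho>) @ [(\<sigma>, e i v)]"
    using r by (simp add: take_Suc_conv_app_nth map_run_def \<sigma>v)
  ultimately show ?case
    by simp
qed

lemma error_run_derivable:
  assumes HH: "proof_space VN VD C U HH" "generators \<subseteq> HH" and i: "i \<in> I"
    and \<rho>: "\<rho> \<in> error_runs C (T i) (P i)"
  shows "(top_assn, map_run (e i) \<rho>, bot_assn) \<in> HH"
proof -
  obtain \<Lambda> where \<Lambda>: "\<Lambda> 0 = init_loc C (T i)"
    "\<And>r. r < length \<rho> \<Longrightarrow> loc_step C (T i) (P i) (\<Lambda> r) (\<rho> ! r) (\<Lambda> (Suc r))"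
    "lerr C \<in> \<Lambda> (length \<rho>) ` univ (T i)"
    using \<rho> unfolding error_runs_def by blast
  have locs: "\<Lambda> r \<in> univ (T i) \<rightarrow>\<^sub>E locs C" if "r \<le> length \<rho>" for r
    using that
  proof (induction r)
    case 0
    then show ?case
      using C by (auto simp: \<Lambda>(1) init_loc_def is_control_def)
  next
    case (Suc r)
    then have "loc_step C (T i) (P i) (\<Lambda> r) (\<rho> ! r) (\<Lambda> (Suc r))" "\<Lambda> r \<in> univ (T i) \<rightarrow>\<^sub>E locs C"
      using \<Lambda>(2) by auto
    then show ?case
      using loc_update[OF i] by (cases "\<rho> ! r") (simp add: loc_step_def del: fun_upd_apply)
  qed
  obtain u where u: "u \<in> univ (T i)" "\<Lambda> (length \<rho>) u = lerr C"
    using \<Lambda>(3) by auto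
  \<comment> \<open>Only the node at the error location has to be covered; repeating it fills the k
    + 1 places.\<close>
  obtain j f where j: "j \<in> J" and f: "embedding VN (T j) (T i) f"
    and cover: "set (replicate (length us + 1) u) \<subseteq> f ` univ (T j)"
    by (rule basis_cover[OF i, of "replicate (length us + 1) u"]) (use u in auto)
  define loc where "loc = restrict (\<Lambda> (length \<rho>) \<circ> f) (univ (T j))"
  have "loc \<in> univ (T j) \<rightarrow>\<^sub>E locs C"
    using restrict_loc_PiE[OF locs f] by (simp add: loc_def)
  moreover have "lerr C \<in> loc ` univ (T j)"
    using cover u(2) by (force simp: loc_def)
  ultimately have "(inv_assn j loc, [], bot_assn) \<in> error_triples j"
    unfolding error_triples_def by blast
  then have "map_triple (e i \<circ> f) (inv_assn j loc, [], bot_assn) \<in> HH"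
    by (intro generator_transfer[OF HH i j f]) blast
  then have "(map_assn (e i \<circ> f) (inv_assn j loc), [], bot_assn) \<in> HH"
    by (simp add: map_triple_def map_run_def map_assn_def bot_assn_def)
  moreover have "([], map_run (e i) \<rho>, map_assn (e i \<circ> f) (inv_assn j loc)) \<in> HH"
    unfolding loc_def
    using conjunct_derivable[OF HH i \<Lambda>(1,2) locs, of _ "length \<rho>"]
    by (intro inv_assn_derivable[OF HH(1) i j f]) simp
  ultimately have "([], map_run (e i) \<rho> @ [], bot_assn) \<in> HH"
    using HH(1) unfolding proof_space_def sequencing_closed_def by blast
  then show ?thesis
    by (simp add: top_assn_def)
qed

lemma ex_safety_proof_space:
  "\<exists>HH :: ('g, 'q, 'c, 'u) triple set.
    finitely_generated VN VD C U HH \<and> proves_safe VN D C I T P U e HH"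
proof -
  obtain HH :: "('g, 'q, 'c, 'u) triple set" where HH: "generated_by VN VD C U generators HH"
    using ex_generated_proof_space[OF generators_triples] by blast
  have "is_struct VN U"
    using U by (simp add: universal_structure_def)
  then have "proof_space VN VD C U {h \<in> triples VD C U. triple_valid VN D U (usem VN I T P U) h}"
    by (rule proof_space_valid[OF D_nonempty])
  \<comment> \<open>Minimality of \<open>HH\<close>: the valid triples form a proof space that
    contains the generators.\<close>
  then have "HH \<subseteq> {h \<in> triples VD C U. triple_valid VN D U (usem VN I T P U) h}"
    using HH generators_triples generators_valid unfolding generated_by_def by blast
  moreover have "(top_assn, map (\<lambda>(\<sigma>, v). (\<sigma>, e i v)) \<rho>, bot_assn) \<in> HH"
    if "i \<in> I" "\<rho> \<in> error_runs C (T i) (P i)" for i \<rho>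
    using error_run_derivable[OF _ _ that] HH by (simp add: generated_by_def map_run_def)
  ultimately have "proves_safe VN D C I T P U e HH"
    unfolding proves_safe_def space_lang_def by blast
  then show ?thesis
    using HH finite_generators unfolding finitely_generated_def by blast
qed

end

theorem theorem6p9:
  fixes VN :: "('f, 'p) vocab" and VD :: "('g, 'q) vocab"
    and D :: "('g, 'q, 'd) fostruct" and C :: "('c, 'l) control"
    and I :: "'i set" and T :: "'i \<Rightarrow> ('f, 'p, 'v) fostruct"
    and P :: "'i \<Rightarrow> ('c, 'v, 'd) program"
    and U :: "('f, 'p, 'u) fostruct" and e :: "'i \<Rightarrow> 'v \<Rightarrow> 'u"
    and \<Phi> :: "('f, 'p, 'g, 'q, 'l) afm" and k :: nat
  assumes "is_struct VD D"
    and "is_control C"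
    and "parameterized_program VN D C I T P"
    and "universal_structure VN I T U e"
    and "ashcroft_assertion VN VD C k \<Phi>"
    and "\<forall>i \<in> I. ashcroft_invariant VN D C (T i) (P i) \<Phi>"
    and "\<exists>SS. is_basis VN (k + 1) (T ` I) SS \<and> finite SS \<and> (\<forall>S \<in> SS. finite (univ S))"
  shows "\<exists>HH :: ('g, 'q, 'c, 'u) triple set.
    finitely_generated VN VD C U HH \<and> proves_safe VN D C I T P U e HH"
proof -
  obtain us \<phi> where \<phi>: "length us = k" "qf_ashcroft VN VD C \<phi>" "afm_nfv \<phi> \<subseteq> set us"
    "\<Phi> = foldr AAllN us \<phi>"
    using assms(5) unfolding ashcroft_assertion_def by blast
  obtain SS where SS: "is_basis VN (k + 1) (T ` I) SS" "finite SS" "\<forall>S \<in> SS. finite (univ S)"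
    using assms(7) by blast
  then have "SS \<subseteq> T ` I"
    by (simp add: is_basis_def)
  then obtain J where J: "J \<subseteq> I" "finite J" "SS = T ` J"
    using finite_subset_image[OF SS(2)] by blast
  obtain ls where "set ls = locs C"
    using finite_list[of "locs C"] assms(2) unfolding is_control_def by blast
  moreover have "\<And>i. i \<in> I \<Longrightarrow> ashcroft_invariant VN D C (T i) (P i) (foldr AAllN us \<phi>)"
    using assms(6) \<phi>(4) by blast
  moreover have "is_basis VN (length us + 1) (T ` I) (T ` J)" "\<And>j. j \<in> J \<Longrightarrow> finite (univ (T j))"
    using SS(1,3) \<phi>(1) J(3) by blast+
  ultimately interpret ashcroft_setting VN VD D C I T P U e us \<phi> ls J
    using assms(1-4) \<phi>(2,3) J(1,2) by unfold_locales
  show ?thesis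
    by (rule ex_safety_proof_space)
qed

end
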